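(* Let $n\ge 1$, let $f,g\in A^2(\mathbb{D})$, and let $\phi(z)=\sum_{i=0}^n a_i(z)\bar z^i$ with $a_0,\dots,a_n\in H^\infty(\mathbb{D})$. Then $T_\phi(f)=g$ if and only if $$\prod_{i=2}^{n+1}(zD+i)\,(g)=D_\phi(f).$$ In particular, $T_\phi(f)=0$ if and only if $D_\phi(f)=0$.
   Context: $\mathbb{D}=\{z\in\mathbb{C}:|z|<1\}$ is the open unit disc, $H(\mathbb{D})$ is the space of holomorphic functions on $\mathbb{D}$, and $H^\infty(\mathbb{D})$ is the space of bounded holomorphic functions on $\mathbb{D}$. $A^2(\mathbb{D})$ is the Bergman space of holomorphic functions on $\mathbb{D}$ that are square integrable with respect to normalized Lebesgue area measure. For $\phi\in L^\infty(\mathbb{D})$ the Toeplitz operator $T_\phi:A^2(\mathbb{D})\to A^2(\mathbb{D})$ is $T_\phi(f)=P(\phi f)$, where $P:L^2(\mathbb{D})\to A^2(\mathbb{D})$ is the orthogonal projection. $D=\frac{\partial}{\partial z}:H(\mathbb{D})\to H(\mathbb{D})$ is differentiation, and a holomorphic function is identified with the operator of multiplication by it; products are compositions of operators. For $\phi(z)=\sum_{i=0}^n a_i(z)\bar z^i$ with $a_i\in H(\mathbb{D})$, the differential operator $D_\phi:H(\mathbb{D})\to H(\mathbb{D})$ is $$D_\phi=\prod_{k=2}^{n+1}(zD+k)\,a_0(z)+\sum_{i=1}^n\ \prod_{k=i+2}^{n+1}(zD+k)\,D^i\,a_i(z),$$ where an empty product is the identity; thus $D_\phi(f)=\prod_{k=2}^{n+1}(zD+k)(a_0f)+\sum_{i=1}^n\prod_{k=i+2}^{n+1}(zD+k)D^i(a_if)$.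 *)

theory Defs
  imports "HOL-Complex_Analysis.Complex_Analysis"
begin

text \<open>
  A function on the open unit disc is represented by a total function on the complex
  numbers whose values outside the disc are irrelevant; equality of such functions is therefore
  stated pointwise on the disc.
\<close>

abbreviation unit_disc :: "complex set" where
  "unit_disc \<equiv> ball 0 1"

definition area_measure :: "complex measure" where
  "area_measure = uniform_measure (lebesgue_on unit_disc) unit_disc"

definition L2_disc :: "(complex \<Rightarrow> complex) set" where
  "L2_disc = {f \<in> borel_measurable area_measure. integrable area_measure (\<lambda>z. (cmod (f z))\<^sup>2)}"

definition L2_inner :: "(complex \<Rightarrow> complex) \<Rightarrow> (complex \<Rightarrow> complex) \<Rightarrow> complex" where
  "L2_inner f g = (LINT z|area_measure. f z * cnj (g z))"

definition bergman_space :: "(complex \<Rightarrow> complex) set" where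
  "bergman_space = {f. f holomorphic_on unit_disc \<and> f \<in> L2_disc}"

definition Hinf_disc :: "(complex \<Rightarrow> complex) set" where
  "Hinf_disc = {f. f holomorphic_on unit_disc \<and> bounded (f ` unit_disc)}"

text \<open>
  The orthogonal projection of \<^term>\<open>h \<in> L2_disc\<close> onto the Bergman space is the element
  of that space whose difference to \<^term>\<open>h\<close> is orthogonal to the whole space. The condition that it
  vanishes off the disc only serves to single out one representative.
\<close>

definition bergman_projection :: "(complex \<Rightarrow> complex) \<Rightarrow> complex \<Rightarrow> complex" where
  "bergman_projection h = (THE u. u \<in> bergman_space \<and> (\<forall>z. z \<notin> unit_disc \<longrightarrow> u z = 0) \<and>
     (\<forall>v\<in>bergman_space. L2_inner (\<lambda>z. h z - u z) v = 0))"

definition toeplitz :: "(complex \<Rightarrow> complex) \<Rightarrow> (complex \<Rightarrow> complex) \<Rightarrow> complex \<Rightarrow> complex" where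
  "toeplitz \<phi> f = bergman_projection (\<lambda>z. \<phi> z * f z)"

definition zD_plus :: "nat \<Rightarrow> (complex \<Rightarrow> complex) \<Rightarrow> complex \<Rightarrow> complex" where
  "zD_plus k h = (\<lambda>z. z * deriv h z + of_nat k * h z)"

text \<open>
  The composition \<open>(zD + l) (zD + (l + 1)) \<dots> (zD + m)\<close>, which is the identity if \<open>l > m\<close>.
\<close>

definition zD_prod :: "nat \<Rightarrow> nat \<Rightarrow> (complex \<Rightarrow> complex) \<Rightarrow> complex \<Rightarrow> complex" where
  "zD_prod l m h = foldr zD_plus [l..<Suc m] h"

text \<open>
  The operator \<open>D\<^sub>\<phi>\<close>, given through the coefficient functions \<open>a\<^sub>0, \<dots>, a\<^sub>n\<close> of
  \<open>\<phi>(z) = (\<Sum>i\<le>n. a\<^sub>i(z) * cnj z ^ i)\<close>.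
\<close>

definition D_op :: "nat \<Rightarrow> (nat \<Rightarrow> complex \<Rightarrow> complex) \<Rightarrow> (complex \<Rightarrow> complex) \<Rightarrow> complex \<Rightarrow> complex" where
  "D_op n a f = (\<lambda>z. zD_prod 2 (n + 1) (\<lambda>w. a 0 w * f w) z +
     (\<Sum>i=1..n. zD_prod (i + 2) (n + 1) ((deriv ^^ i) (\<lambda>w. a i w * f w)) z))"

end

theory Submission
  imports Defs
begin

text \<open>
  Everything is read off from Taylor coefficients at \<open>0\<close>. The monomials are pairwise orthogonal
  in the Bergman space and \<open>\<parallel>z\<^sup>k\<parallel>\<^sup>2 = 1 / (k + 1)\<close>
  (\<open>integral_area_measure_monomials\<close>); hence \<open>\<langle>F, z\<^sup>m\<rangle> = c\<^sub>m / (m + 1)\<close> for a square integrable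
  \<open>F = \<Sum> c\<^sub>k z\<^sup>k\<close> (\<open>integral_against_monomial\<close>), such \<open>F\<close> are exactly the power series with
  \<open>\<Sum> \<bar>c\<^sub>k\<bar>\<^sup>2 / (k + 1) < \<infinity>\<close>, and their partial sums converge to them in mean square. So a square
  integrable function is orthogonal to the whole Bergman space as soon as it is orthogonal to all
  monomials (\<open>orthogonal_to_bergman_space_iff\<close>).

  Write \<open>a\<^sub>i f = \<Sum> c\<^sub>i\<^sub>,\<^sub>k z\<^sup>k\<close>. Because \<open>\<langle>cnj z\<^sup>i a\<^sub>i f, z\<^sup>m\<rangle> = \<langle>a\<^sub>i f, z\<^bsup>m+i\<^esup>\<rangle>\<close>, the
  \<open>m\<close>-th coefficient of the projection of \<open>\<phi> f\<close> has to be
  \<open>T\<^sub>m = \<Sum>i\<le>n. (m + 1) / (m + i + 1) * c\<^sub>i\<^sub>,\<^sub>m\<^sub>+\<^sub>i\<close>. These numbers satisfy the summability condition,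
  so they do define a function in the Bergman space, and it is the projection
  (\<open>bergman_projection_antianalytic_polynomial\<close>).

  On the other side, \<open>zD + k\<close> multiplies the \<open>j\<close>-th coefficient by \<open>j + k\<close>, while \<open>D\<^sup>i\<close> moves the
  coefficient with index \<open>j + i\<close> to index \<open>j\<close> and multiplies it by \<open>(j + 1) \<dots> (j + i)\<close>. In each
  summand of \<open>D\<^sub>\<phi> f\<close> the factors \<open>j + 1, \<dots>, j + n + 1\<close> therefore all occur once, except
  \<open>j + i + 1\<close>, so that the \<open>j\<close>-th coefficient of \<open>D\<^sub>\<phi> f\<close> is \<open>P\<^sub>j T\<^sub>j\<close> with
  \<open>P\<^sub>j = (j + 2) \<dots> (j + n + 1)\<close> (\<open>disc_series_D_op\<close>). The operator applied to \<open>g\<close> multiplies its \<open>j\<close>-th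
  coefficient by the same \<open>P\<^sub>j\<close>, which is nonzero. Thus the differential equation says
  that \<open>g\<close> has the coefficients \<open>T\<^sub>j\<close>, that is, \<open>g = T\<^sub>\<phi> f\<close>.
\<close>

section \<open>Power series on the disc\<close>

definition disc_series :: "(nat \<Rightarrow> complex) \<Rightarrow> (complex \<Rightarrow> complex) \<Rightarrow> bool" where
  "disc_series c F \<longleftrightarrow> (\<forall>z\<in>unit_disc. (\<lambda>k. c k * z ^ k) sums F z)"

lemma disc_series_of_holomorphic:
  assumes "F holomorphic_on unit_disc"
  obtains c where "disc_series c F"
proof
  show "disc_series (\<lambda>k. (deriv ^^ k) F 0 / fact k) F"
    using holomorphic_power_series[OF assms] by (simp add: disc_series_def)
qed

lemma disc_series_holomorphic:
  assumes "disc_series c F"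
  shows "F holomorphic_on unit_disc"
  using assms unfolding disc_series_def by (intro power_series_holomorphic[of 0 1 c]) auto

lemma disc_series_cong:
  assumes "disc_series c F" "\<And>z. z \<in> unit_disc \<Longrightarrow> F z = G z"
  shows "disc_series c G"
  using assms by (simp add: disc_series_def)

lemma disc_series_value_eq:
  assumes "disc_series c F" "disc_series c G" "z \<in> unit_disc"
  shows "F z = G z"
  using assms unfolding disc_series_def by (blast dest: sums_unique2)

lemma disc_series_sum:
  assumes "\<And>i. i \<in> I \<Longrightarrow> disc_series (c i) (F i)"
  shows "disc_series (\<lambda>k. \<Sum>i\<in>I. c i k) (\<lambda>z. \<Sum>i\<in>I. F i z)"
  using assms by (auto simp: disc_series_def sum_distrib_right intro!: sums_sum)

lemma disc_series_deriv:
  assumes "disc_series c F"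
  shows "disc_series (\<lambda>k. of_nat (Suc k) * c (Suc k)) (deriv F)"
  unfolding disc_series_def
proof
  fix z :: complex assume z: "z \<in> unit_disc"
  have "(F has_field_derivative deriv F z) (at z)"
    using disc_series_holomorphic[OF assms] z by (simp add: holomorphic_derivI)
  then have "(\<lambda>n. diffs c n * z ^ n) sums deriv F z"
    using assms z by (intro termdiffs_sums_strong[of 1 c F]) (auto simp: disc_series_def)
  then show "(\<lambda>k. of_nat (Suc k) * c (Suc k) * z ^ k) sums deriv F z"
    by (simp add: diffs_def)
qed

text \<open>
  Evaluation at \<open>0\<close> gives the constant coefficient, and differentiation moves every other
  coefficient one place down.
\<close>

lemma disc_series_unique:
  assumes "disc_series c F" "disc_series d F"
  shows "c = d"
proof
  show "c k = d k" for k
    using assms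
  proof (induction k arbitrary: c d F)
    case 0
    then have "(\<lambda>k. c k * 0 ^ k) sums F 0" "(\<lambda>k. d k * 0 ^ k) sums F 0"
      unfolding disc_series_def by (meson centre_in_ball zero_less_one)+
    then show ?case by simp
  next
    case (Suc k)
    show ?case
      using Suc.IH[OF Suc.prems[THEN disc_series_deriv]] by (simp del: of_nat_Suc)
  qed
qed

lemma disc_series_eq_iff:
  assumes "disc_series c F" "disc_series d G"
  shows "(\<forall>z\<in>unit_disc. F z = G z) \<longleftrightarrow> c = d"
proof
  assume "\<forall>z\<in>unit_disc. F z = G z"
  then have "disc_series c G" using disc_series_cong[OF assms(1)] by blast
  then show "c = d" using assms(2) by (rule disc_series_unique)
next
  assume "c = d"
  with assms show "\<forall>z\<in>unit_disc. F z = G z" using disc_series_value_eq by blast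
qed

lemma disc_series_funpow_deriv:
  assumes "disc_series c F"
  shows "disc_series (\<lambda>k. (\<Prod>l=1..i. of_nat (k + l)) * c (k + i)) ((deriv ^^ i) F)"
proof (induction i)
  case 0
  then show ?case using assms by simp
next
  case (Suc i)
  have "of_nat (Suc k) * ((\<Prod>l=1..i. of_nat (Suc k + l)) * c (Suc k + i)) =
        (\<Prod>l=1..Suc i. of_nat (k + l)) * c (k + Suc i)" for k
    by (simp add: prod.atLeast_Suc_atMost prod.shift_bounds_cl_Suc_ivl del: prod.cl_ivl_Suc of_nat_Suc of_nat_add)
  with disc_series_deriv[OF Suc] show ?case by (simp only: funpow.simps o_def)
qed

text \<open>
  The monomials are the eigenfunctions of the Euler operator: \<open>zD z\<^sup>j = j z\<^sup>j\<close>.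
\<close>

lemma disc_series_zD_plus:
  assumes "disc_series c F"
  shows "disc_series (\<lambda>j. of_nat (j + k) * c j) (zD_plus k F)"
  unfolding disc_series_def
proof
  fix z :: complex assume z: "z \<in> unit_disc"
  have "(\<lambda>j. z * (of_nat (Suc j) * c (Suc j) * z ^ j)) sums (z * deriv F z)"
    using disc_series_deriv[OF assms] z by (intro sums_mult) (auto simp: disc_series_def)
  then have "(\<lambda>j. of_nat (Suc j) * c (Suc j) * z ^ Suc j) sums (z * deriv F z)"
    by (simp add: mult_ac)
  then have "(\<lambda>j. of_nat j * c j * z ^ j) sums (z * deriv F z)"
    by (subst (asm) sums_Suc_iff) simp
  moreover have "(\<lambda>j. of_nat k * (c j * z ^ j)) sums (of_nat k * F z)"
    using assms z by (intro sums_mult) (auto simp: disc_series_def)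
  ultimately have "(\<lambda>j. of_nat j * c j * z ^ j + of_nat k * (c j * z ^ j)) sums
      (z * deriv F z + of_nat k * F z)"
    by (rule sums_add)
  then show "(\<lambda>j. of_nat (j + k) * c j * z ^ j) sums zD_plus k F z"
    by (simp add: zD_plus_def algebra_simps)
qed

lemma disc_series_zD_prod:
  assumes "disc_series c F"
  shows "disc_series (\<lambda>j. (\<Prod>k=l..m. of_nat (j + k)) * c j) (zD_prod l m F)"
proof -
  have series: "disc_series (\<lambda>j. prod_list (map (\<lambda>k. of_nat (j + k)) ks) * c j) (foldr zD_plus ks F)" for ks
  proof (induction ks)
    case Nil
    then show ?case using assms by simp
  next
    case (Cons k ks)
    from disc_series_zD_plus[OF this, of k] show ?case
      by (simp only: list.map prod_list.Cons foldr.simps o_def mult.assoc)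
  qed
  have prod_eq: "prod_list (map (\<lambda>k. of_nat (j + k)) [l..<Suc m]) = (\<Prod>k=l..m. of_nat (j + k) :: complex)" for j
    by (subst prod.distinct_set_conv_list[symmetric])
       (simp_all only: distinct_upt set_upt atLeastLessThanSuc_atLeastAtMost)
  \<comment> \<open>The interval \<open>[l..<Suc m]\<close> has no repetitions, so the product over the list is one over a set.\<close>
  from series[of "[l..<Suc m]"] show ?thesis
    by (simp only: prod_eq zD_prod_def)
qed

section \<open>Rotation invariance of Lebesgue measure on the plane\<close>

lemma ball_image_mult_unimodular:
  fixes c x :: complex
  assumes "cmod c = 1"
  shows "(*) c ` ball x r = ball (c * x) r"
proof -
  have iso: "dist (c * x) (c * y) = dist x y" for x y
    using assms by (simp add: dist_norm right_diff_distrib[symmetric] norm_mult)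
  have "c \<noteq> 0" using assms by auto
  have "y \<in> (*) c ` ball x r" if y: "y \<in> ball (c * x) r" for y
  proof
    show eq: "y = c * (y / c)" using \<open>c \<noteq> 0\<close> by simp
    show "y / c \<in> ball x r" using y iso[of x "y / c"] by (simp only: eq[symmetric] mem_ball)
  qed
  with iso show ?thesis by auto
qed

text \<open>
  By Vitali's covering theorem an open set is, up to a null set, a disjoint union of countably many
  balls. A rotation maps balls to balls of the same radius, hence of the same area. Comparing only
  from below avoids having to know that rotations preserve null sets.
\<close>

lemma emeasure_open_le_rotation:
  fixes c :: complex
  assumes c: "cmod c = 1" and U: "open U"
  shows "emeasure lborel U \<le> emeasure lborel ((*) c ` U)"
proof -
  define K where "K = {(x, r). ball x r \<subseteq> U}"
  have cover: "\<exists>i. i \<in> K \<and> x \<in> ball (fst i) (snd i) \<and> snd i < d" if "x \<in> U" "0 < d" for x and d :: real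
  proof -
    obtain e where "e > 0" "ball x e \<subseteq> U" using openE[OF U \<open>x \<in> U\<close>] by metis
    then have "ball x (min e (d/2)) \<subseteq> U" by (meson min.cobounded1 subset_ball subset_trans)
    then have "(x, min e (d/2)) \<in> K" by (simp add: K_def)
    then show ?thesis using \<open>e > 0\<close> \<open>0 < d\<close>
      by (intro exI[of _ "(x, min e (d/2))"]) (simp add: min_less_iff_disj)
  qed
  obtain C where C: "countable C" "C \<subseteq> K"
      "pairwise (\<lambda>i j. disjnt (ball (fst i) (snd i)) (ball (fst j) (snd j))) C"
      "negligible (U - (\<Union>i\<in>C. ball (fst i) (snd i)))"
    by (rule Vitali_covering_theorem_balls[of U K fst snd, OF cover]) (assumption | rule that)+
  define B where "B i = ball (fst i) (snd i)" for i :: "complex \<times> real"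
  have dis: "disjoint_family_on B C"
    using C(3) by (auto simp: disjoint_family_on_def pairwise_def disjnt_def B_def)
  have c0: "c \<noteq> 0" using c by auto
  have dis': "disjoint_family_on (\<lambda>i. (*) c ` B i) C"
    using dis c0 unfolding disjoint_family_on_def by (simp add: image_Int[symmetric] inj_on_def)
  have img: "(*) c ` B i = ball (c * fst i) (snd i)" for i
    using ball_image_mult_unimodular[OF c] by (simp add: B_def)
  have eq: "emeasure lborel ((*) c ` B i) = emeasure lborel (B i)" for i
  \<comment> \<open>The covering may contain balls of negative radius, which are empty.\<close>
  proof (cases "snd i \<ge> 0")
    case True
    then show ?thesis unfolding img unfolding B_def by (simp only: emeasure_ball[OF True])
  next
    case False
    then have "ball x (snd i) = {}" for x :: complex by simp
    then show ?thesis unfolding img unfolding B_def by (simp only:)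
  qed
  have Bo: "B i \<in> sets borel" for i by (simp add: B_def)
  have V: "open (\<Union>i\<in>C. B i)" by (auto simp: B_def)
  then have W: "U - (\<Union>i\<in>C. B i) \<in> sets lborel" using U by simp
  then have null: "U - (\<Union>i\<in>C. B i) \<in> null_sets lborel"
    using C(4) unfolding B_def[symmetric] negligible_iff_null_sets by (simp only: null_sets_completion_iff)
  have "emeasure lborel U \<le> emeasure lborel ((\<Union>i\<in>C. B i) \<union> (U - (\<Union>i\<in>C. B i)))"
    using V W by (intro emeasure_mono sets.Un) auto
  also have "\<dots> = emeasure lborel (\<Union>i\<in>C. B i)"
    using null V by (intro emeasure_Un_null_set) auto
  also have "\<dots> = (\<integral>\<^sup>+i. emeasure lborel (B i) \<partial>count_space C)"
    using C(1) dis by (intro emeasure_UN_countable) (simp_all add: Bo)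
  also have "\<dots> = (\<integral>\<^sup>+i. emeasure lborel ((*) c ` B i) \<partial>count_space C)"
    by (simp only: eq)
  also have "\<dots> = emeasure lborel (\<Union>i\<in>C. (*) c ` B i)"
    using C(1) dis' by (intro emeasure_UN_countable[symmetric]) (simp_all add: img)
  also have "\<dots> \<le> emeasure lborel ((*) c ` U)"
  proof (intro emeasure_mono)
    have "B i \<subseteq> U" if "i \<in> C" for i
      using subsetD[OF C(2) that] by (simp add: B_def K_def case_prod_unfold)
    then show "(\<Union>i\<in>C. (*) c ` B i) \<subseteq> (*) c ` U" by blast
    have "z \<in> (*) c ` U" if "z / c \<in> U" for z
      using that c0 by (intro image_eqI[of _ _ "z / c"]) auto
    then have "(*) c ` U = (\<lambda>z. z / c) -` U" using c0 by auto
    moreover have "open ((\<lambda>z. z / c) -` U)"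
      using U c0 by (auto intro!: open_vimage continuous_intros)
    ultimately show "(*) c ` U \<in> sets lborel" by simp
  qed
  finally show ?thesis .
qed

text \<open>
  The opposite inequality is the same estimate for the inverse rotation; boxes are open and determine
  Lebesgue measure.
\<close>

lemma lborel_distr_rotation:
  fixes c :: complex
  assumes c: "cmod c = 1"
  shows "distr lborel borel ((*) c) = lborel"
proof -
  have c0: "c \<noteq> 0" using c by auto
  have eq: "emeasure lborel ((*) c -` U) = emeasure lborel U" if U: "open U" for U
  proof (rule antisym)
    have V: "open ((*) c -` U)" using U by (intro open_vimage continuous_intros)
    have "(*) c ` ((*) c -` U) = U"
      by (intro surj_image_vimage_eq surjI[of _ "\<lambda>z. z / c"]) (simp add: c0)
    then show "emeasure lborel ((*) c -` U) \<le> emeasure lborel U"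
      using emeasure_open_le_rotation[OF c V] by simp
    have "z \<in> (*) (inverse c) ` U" if "c * z \<in> U" for z
      using that c0 by (intro image_eqI[of _ _ "c * z"]) auto
    then have "(*) (inverse c) ` U = (*) c -` U" using c0 by (auto simp: mult.assoc[symmetric])
    then show "emeasure lborel U \<le> emeasure lborel ((*) c -` U)"
      using emeasure_open_le_rotation[of "inverse c" U] c U by (simp add: norm_inverse)
  qed
  have "lborel = distr lborel borel ((*) c)"
  proof (rule lborel_eqI)
    fix l u :: complex assume "\<And>b. b \<in> Basis \<Longrightarrow> l \<bullet> b \<le> u \<bullet> b"
    then show "emeasure (distr lborel borel ((*) c)) (box l u) = ennreal (\<Prod>b\<in>Basis. (u - l) \<bullet> b)"
      by (subst emeasure_distr) (simp_all add: eq[OF open_box] emeasure_lborel_box)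
  qed simp
  then show ?thesis by simp
qed

section \<open>Normalized area measure on the disc\<close>

lemma emeasure_lborel_disc: "0 \<le> r \<Longrightarrow> emeasure lborel (ball (0::complex) r) = ennreal (pi * r\<^sup>2)"
  by (simp add: emeasure_ball unit_ball_vol_2)

lemma space_area_measure [simp]: "space area_measure = unit_disc"
  by (simp add: area_measure_def)

lemma sets_area_measure: "sets area_measure = sets (lebesgue_on unit_disc)"
  by (simp add: area_measure_def)

lemma borel_measurable_area_measure_of_borel:
  "g \<in> borel_measurable borel \<Longrightarrow> g \<in> borel_measurable area_measure"
  unfolding measurable_cong_sets[OF sets_area_measure refl]
  by (intro measurable_restrict_space1 measurable_completion) simp

lemma borel_measurable_area_measure_of_continuous:
  fixes g :: "complex \<Rightarrow> 'a::euclidean_space"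
  assumes "continuous_on unit_disc g"
  shows "g \<in> borel_measurable area_measure"
  unfolding measurable_cong_sets[OF sets_area_measure refl]
  using assms by (intro continuous_imp_measurable_on_sets_lebesgue) auto

text \<open>
  The area measure lives on the Lebesgue sets of the disc. Its restriction to Borel sets is the
  uniform distribution, which makes Borel functions accessible to image measures.
\<close>

lemma distr_area_measure: "distr area_measure borel (\<lambda>z. z) = uniform_measure lborel unit_disc"
proof (rule measure_eqI)
  fix A assume "A \<in> sets (distr area_measure borel (\<lambda>z. z))"
  then have A: "A \<in> sets borel" by simp
  have [measurable]: "(\<lambda>z. z) \<in> borel_measurable area_measure"
    by (rule borel_measurable_area_measure_of_borel) measurable
  have D: "unit_disc \<inter> A \<in> sets lborel" using A by simp
  then have DL: "unit_disc \<inter> A \<in> sets lebesgue" by (rule sets_completionI_sets)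
  have "emeasure (distr area_measure borel (\<lambda>z. z)) A = emeasure area_measure (unit_disc \<inter> A)"
    using A by (subst emeasure_distr) (auto simp: Int_commute)
  also have "\<dots> = emeasure lebesgue (unit_disc \<inter> A) / emeasure lebesgue unit_disc"
    unfolding area_measure_def using DL
    by (subst emeasure_uniform_measure) (auto simp: emeasure_restrict_space sets_restrict_space Int_assoc[symmetric])
  also have "\<dots> = emeasure (uniform_measure lborel unit_disc) A"
    using A D by simp
  finally show "emeasure (distr area_measure borel (\<lambda>z. z)) A = emeasure (uniform_measure lborel unit_disc) A" .
qed simp

lemma emeasure_area_measure:
  assumes A: "A \<in> sets borel" "A \<subseteq> unit_disc"
  shows "emeasure area_measure A = emeasure lborel A / ennreal pi"
proof -
  have "emeasure area_measure A = emeasure (distr area_measure borel (\<lambda>z. z)) A"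
    using A by (subst emeasure_distr[OF borel_measurable_area_measure_of_borel])
      (auto simp: Int_absorb2)
  also have "\<dots> = emeasure lborel A / ennreal pi"
    using A emeasure_lborel_disc[of 1] by (simp add: distr_area_measure Int_absorb1)
  finally show ?thesis .
qed

interpretation area_measure: finite_measure area_measure
proof
  show "emeasure area_measure (space area_measure) \<noteq> \<infinity>"
    using emeasure_area_measure[of unit_disc] emeasure_lborel_disc[of 1] by (simp add: ennreal_divide_eq_top_iff)
qed

lemma integral_area_measure_rotation:
  fixes g :: "complex \<Rightarrow> complex"
  assumes g: "g \<in> borel_measurable borel" and c: "cmod c = 1"
  shows "(LINT z|area_measure. g (c * z)) = (LINT z|area_measure. g z)"
proof -
  have rot: "(\<lambda>z. c * z) \<in> borel_measurable borel" and id: "(\<lambda>z. z) \<in> borel_measurable borel"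
    by (intro borel_measurable_continuous_onI continuous_intros)+
  note rot' = borel_measurable_area_measure_of_borel[OF rot]
  note id' = borel_measurable_area_measure_of_borel[OF id]
  have "distr area_measure borel (\<lambda>z. c * z) = distr area_measure borel (\<lambda>z. z)"
  proof (rule measure_eqI)
    fix A assume "A \<in> sets (distr area_measure borel (\<lambda>z. c * z))"
    then have A: "A \<in> sets borel" by simp
    then have DA: "unit_disc \<inter> A \<in> sets borel" by simp
    then have R: "(\<lambda>z. c * z) -` (unit_disc \<inter> A) \<in> sets borel"
      by (rule measurable_sets_borel[OF rot])
    have "emeasure (distr area_measure borel (\<lambda>z. c * z)) A
        = emeasure area_measure ((\<lambda>z. c * z) -` (unit_disc \<inter> A))"
      unfolding emeasure_distr[OF rot' A]
      by (rule arg_cong[of _ _ "emeasure area_measure"]) (auto simp: norm_mult c)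
    also have "\<dots> = emeasure lborel ((\<lambda>z. c * z) -` (unit_disc \<inter> A)) / ennreal pi"
      by (rule emeasure_area_measure[OF R]) (auto simp: norm_mult c)
    also have "emeasure lborel ((\<lambda>z. c * z) -` (unit_disc \<inter> A)) = emeasure lborel (unit_disc \<inter> A)"
      using emeasure_distr[of "(*) c" lborel borel "unit_disc \<inter> A"] rot DA
      by (simp add: lborel_distr_rotation[OF c])
    also have "\<dots> / ennreal pi = emeasure area_measure (unit_disc \<inter> A)"
      by (rule emeasure_area_measure[OF DA, symmetric]) auto
    also have "\<dots> = emeasure (distr area_measure borel (\<lambda>z. z)) A"
      unfolding emeasure_distr[OF id' A]
      by (rule arg_cong[of _ _ "emeasure area_measure"]) auto
    finally show "emeasure (distr area_measure borel (\<lambda>z. c * z)) A = emeasure (distr area_measure borel (\<lambda>z. z)) A" .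
  qed simp
  then show ?thesis
    using integral_distr[OF rot' g] integral_distr[OF id' g] by simp
qed

text \<open>
  This replaces polar coordinates: a disc of radius \<open>\<surd>x\<close> has normalized area \<open>x\<close>, so \<open>\<bar>z\<bar>\<^sup>2\<close> is
  uniformly distributed on the unit interval.
\<close>

lemma integral_area_measure_radial:
  fixes g :: "real \<Rightarrow> real"
  assumes [measurable]: "g \<in> borel_measurable borel"
  shows "(LINT z|area_measure. g ((cmod z)\<^sup>2)) = (LINT t|lborel. g t * indicator {0..1} t)"
proof -
  let ?U = "uniform_measure lborel {0..1::real}"
  have [measurable]: "(\<lambda>z. (cmod z)\<^sup>2) \<in> borel_measurable area_measure"
    by (rule borel_measurable_area_measure_of_borel) measurable
  have "distr area_measure borel (\<lambda>z. (cmod z)\<^sup>2) = ?U"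
  proof (rule measure_eqI_lessThan)
    fix x :: real
    have sqrt_less: "x < (cmod z)\<^sup>2 \<longleftrightarrow> sqrt x < cmod z" for z
      using real_sqrt_less_iff[of x "(cmod z)\<^sup>2"] by simp
    let ?A = "{z \<in> unit_disc. x < (cmod z)\<^sup>2}"
    have distr_eq: "emeasure (distr area_measure borel (\<lambda>z. (cmod z)\<^sup>2)) {x<..} = emeasure area_measure ?A"
      by (subst emeasure_distr) (auto intro!: arg_cong[of _ _ "emeasure area_measure"])
    show "emeasure (distr area_measure borel (\<lambda>z. (cmod z)\<^sup>2)) {x<..} < \<infinity>"
      unfolding distr_eq infinity_ennreal_def less_top[symmetric] by (rule area_measure.emeasure_finite)
    have U: "emeasure ?U {x<..} = emeasure lborel ({0..1} \<inter> {x<..})"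
      by (simp add: divide_ennreal_def)
    have "{z \<in> unit_disc. x < (cmod z)\<^sup>2} \<in> sets borel" by measurable
    then have A: "emeasure area_measure ?A = emeasure lborel ?A / ennreal pi"
      by (intro emeasure_area_measure) auto
    consider "x < 0" | "0 \<le> x" "x < 1" | "1 \<le> x" by linarith
    then have "emeasure area_measure ?A = emeasure lborel ({0..1} \<inter> {x<..})"
    proof cases
      case 1
      then have "?A = unit_disc" "{0..1} \<inter> {x<..} = {0..1}"
        by (auto intro: less_le_trans[OF _ zero_le_power2])
      then show ?thesis unfolding A using emeasure_lborel_disc[of 1] by simp
    next
      case 2
      then have "?A = unit_disc - cball 0 (sqrt x)"
        by (auto simp: not_le sqrt_less)
      moreover have "cball 0 (sqrt x) \<subseteq> (unit_disc :: complex set)"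
        using 2 by (force simp: real_sqrt_lt_1_iff intro: le_less_trans)
      ultimately have "emeasure lborel ?A = ennreal pi - ennreal (pi * x)"
        using 2 emeasure_lborel_disc[of 1]
        by (simp add: emeasure_Diff emeasure_cball unit_ball_vol_2)
      also have "\<dots> = ennreal (pi * (1 - x))"
        using 2 by (simp add: ennreal_minus algebra_simps)
      finally have "emeasure area_measure ?A = ennreal (1 - x)"
        unfolding A using 2 by (simp add: divide_ennreal)
      moreover have "{0..1} \<inter> {x<..} = {x<..1}" using 2 by auto
      ultimately show ?thesis using 2 by simp
    next
      case 3
      then have "?A = {}" "{0..1} \<inter> {x<..} = {}"
        by (auto simp: not_less intro: power_le_one[THEN order_trans])
      then show ?thesis by (simp only: emeasure_empty)
    qed
    then show "emeasure (distr area_measure borel (\<lambda>z. (cmod z)\<^sup>2)) {x<..} = emeasure ?U {x<..}"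
      unfolding distr_eq U .
  qed simp_all
  then have "(LINT z|area_measure. g ((cmod z)\<^sup>2)) = (LINT t|?U. g t)"
    by (subst integral_distr[symmetric, of "\<lambda>z. (cmod z)\<^sup>2" area_measure borel g]) auto
  also have "?U = density lborel (\<lambda>t. ennreal (indicator {0..1} t))"
    by (simp add: uniform_measure_def divide_ennreal_def ennreal_indicator)
  also have "(LINT t|\<dots>. g t) = (LINT t|lborel. g t * indicator {0..1} t)"
    by (subst integral_density) (auto simp: mult.commute)
  finally show ?thesis .
qed

section \<open>Integrals against monomials\<close>

text \<open>
  For \<open>j \<noteq> k\<close> a rotation by a suitable angle multiplies the integrand by \<open>-1\<close>. For \<open>j = k\<close> the integrand
  depends on \<open>\<bar>z\<bar>\<^sup>2\<close> only. The cutoff at radius \<open>r\<close> is there because a power series on the disc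
  converges uniformly on smaller discs only.
\<close>

lemma integral_area_measure_monomials:
  assumes r: "0 \<le> r" "r \<le> 1"
  shows "(LINT z|area_measure. indicator (cball 0 r) z * (z ^ j * cnj z ^ k)) =
    (if j = k then complex_of_real (r ^ (2 * k + 2) / (k + 1)) else 0)"
proof (cases "j = k")
  case False
  define I where "I = (LINT z|area_measure. indicator (cball 0 r) z * (z ^ j * cnj z ^ k))"
  \<comment> \<open>The angle is chosen so that \<open>c ^ (j - k) = cis pi = - 1\<close>.\<close>
  define t where "t = pi / (real j - real k)"
  define c where "c = cis t"
  have c: "cmod c = 1" by (simp add: c_def)
  have "c ^ j * cnj c ^ k = cis ((real j - real k) * t)"
    unfolding c_def cis_cnj Complex.DeMoivre cis_mult by (rule arg_cong[of _ _ cis]) (simp add: left_diff_distrib)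
  also have "(real j - real k) * t = pi" using False by (simp add: t_def)
  finally have c_pow: "c ^ j * cnj c ^ k = - 1" by simp
  have meas: "(\<lambda>z. indicator (cball 0 r) z * (z ^ j * cnj z ^ k)) \<in> borel_measurable borel"
    by (intro borel_measurable_times borel_measurable_indicator borel_measurable_continuous_onI continuous_intros) simp
  have "I = (LINT z|area_measure. indicator (cball 0 r) (c * z) * ((c * z) ^ j * cnj (c * z) ^ k))"
    unfolding I_def by (rule integral_area_measure_rotation[OF meas c, symmetric])
  also have "(\<lambda>z. indicator (cball 0 r) (c * z) * ((c * z) ^ j * cnj (c * z) ^ k)) =
      (\<lambda>z. - (indicator (cball 0 r) z * (z ^ j * cnj z ^ k)))"
  proof
    fix z
    have "(c * z) ^ j * cnj (c * z) ^ k = (c ^ j * cnj c ^ k) * (z ^ j * cnj z ^ k)"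
      by (simp add: power_mult_distrib)
    moreover have "indicator (cball 0 r) (c * z) = (indicator (cball 0 r) z :: complex)"
      by (simp add: indicator_def norm_mult c)
    ultimately show "indicator (cball 0 r) (c * z) * ((c * z) ^ j * cnj (c * z) ^ k) =
        - (indicator (cball 0 r) z * (z ^ j * cnj z ^ k))"
      by (simp add: c_pow)
  qed
  also have "(LINT z|area_measure. - (indicator (cball 0 r) z * (z ^ j * cnj z ^ k))) = - I"
    by (simp add: I_def)
  finally show ?thesis using False by (simp add: I_def)
next
  case True
  define g where "g t = indicator {..r\<^sup>2} t * t ^ k" for t :: real
  have g: "g \<in> borel_measurable borel"
    unfolding g_def by (intro borel_measurable_times borel_measurable_indicator borel_measurable_continuous_onI continuous_intros) simp
  have "indicator (cball 0 r) z * (z ^ j * cnj z ^ k) = complex_of_real (g ((cmod z)\<^sup>2))" for z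
  proof -
    have "z ^ j * cnj z ^ k = complex_of_real (((cmod z)\<^sup>2) ^ k)"
    proof -
      have "z ^ j * cnj z ^ k = (z * cnj z) ^ k" by (simp only: True power_mult_distrib)
      then show ?thesis by (simp only: complex_norm_square[symmetric] of_real_power)
    qed
    moreover have "indicator (cball 0 r) z = complex_of_real (indicator {..r\<^sup>2} ((cmod z)\<^sup>2))"
      using r power_mono_iff[of "cmod z" r 2] by (simp add: indicator_def)
    ultimately show ?thesis by (simp add: g_def)
  qed
  then have "(LINT z|area_measure. indicator (cball 0 r) z * (z ^ j * cnj z ^ k)) =
      complex_of_real (LINT z|area_measure. g ((cmod z)\<^sup>2))"
    by simp
  also have "(LINT z|area_measure. g ((cmod z)\<^sup>2)) = (LINT t|lborel. g t * indicator {0..1} t)"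
    by (rule integral_area_measure_radial[OF g])
  also have "(\<lambda>t. g t * indicator {0..1} t) = (\<lambda>t. t ^ k * indicator {0..r\<^sup>2} t)"
  proof
    fix t :: real
    have "r\<^sup>2 \<le> 1" using r by (rule power_le_one)
    then have "indicator {..r\<^sup>2} t * indicator {0..1} t = (indicator {0..r\<^sup>2} t :: real)"
      by (simp add: indicator_def)
    then show "g t * indicator {0..1} t = t ^ k * indicator {0..r\<^sup>2} t"
      by (simp add: g_def mult_ac)
  qed
  also have "(LINT t|lborel. t ^ k * indicator {0..r\<^sup>2} t) = r ^ (2 * k + 2) / (k + 1)"
  proof -
    have "(r\<^sup>2) ^ Suc k = r ^ (2 * k + 2)" by (subst power_mult[symmetric]) simp
    then show ?thesis by (simp only: integral_power zero_le_power2) simp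
  qed
  finally show ?thesis using True by simp
qed

lemma integrable_area_measure_bounded:
  fixes g :: "complex \<Rightarrow> 'a::{banach,second_countable_topology}"
  assumes "g \<in> borel_measurable area_measure" "\<And>z. z \<in> unit_disc \<Longrightarrow> norm (g z) \<le> B"
  shows "integrable area_measure g"
proof (rule area_measure.integrable_const_bound)
  show "AE z in area_measure. norm (g z) \<le> B"
    using assms(2) by (intro AE_I2) simp
qed (rule assms(1))

lemma cmod_power_le_one: "z \<in> unit_disc \<Longrightarrow> cmod z ^ k \<le> 1"
  by (simp add: power_le_one)

text \<open>
  On the disc of radius \<open>r < 1\<close> the partial sums are dominated by \<open>\<Sum>k. \<bar>c\<^sub>k\<bar> r\<^sup>k\<close>, so the series may
  be integrated term by term.
\<close>

lemma truncated_coefficient_integral: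
  assumes F: "disc_series c F" and r: "0 \<le> r" "r < 1"
  shows "(LINT z|area_measure. indicator (cball 0 r) z * (F z * cnj z ^ m)) =
    c m * complex_of_real (r ^ (2 * m + 2) / (m + 1))"
proof -
  define s where "s N z = indicator (cball 0 r) z * ((\<Sum>k<N. c k * z ^ k) * cnj z ^ m)" for N z
  have ind: "indicator (cball 0 r) \<in> borel_measurable (borel :: complex measure)"
    by (intro borel_measurable_indicator) simp
  \<comment> \<open>Convergence at a point outside the closed disc of radius \<open>r\<close> gives absolute convergence at \<open>r\<close>.\<close>
  have "summable (\<lambda>k. c k * (of_real ((r + 1) / 2)) ^ k)"
    using F r by (intro sums_summable[of _ "F (of_real ((r + 1) / 2))"])
      (simp add: disc_series_def)
  then have abs_sum: "summable (\<lambda>k. norm (c k * complex_of_real r ^ k))"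
    using r by (rule_tac powser_insidea) auto
  have "(\<lambda>N. LINT z|area_measure. s N z) \<longlonglongrightarrow>
      (LINT z|area_measure. indicator (cball 0 r) z * (F z * cnj z ^ m))"
  proof (rule integral_dominated_convergence[where w = "\<lambda>_. \<Sum>k. norm (c k * complex_of_real r ^ k)"])
    have "continuous_on unit_disc F"
      using disc_series_holomorphic[OF F] by (rule holomorphic_on_imp_continuous_on)
    then show "(\<lambda>z. indicator (cball 0 r) z * (F z * cnj z ^ m)) \<in> borel_measurable area_measure"
      by (intro borel_measurable_times borel_measurable_area_measure_of_borel[OF ind]
          borel_measurable_area_measure_of_continuous continuous_intros)
    show "s N \<in> borel_measurable area_measure" for N
      unfolding s_def
      by (intro borel_measurable_times borel_measurable_area_measure_of_borel[OF ind]
          borel_measurable_area_measure_of_continuous continuous_intros)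
    show "AE z in area_measure. (\<lambda>N. s N z) \<longlonglongrightarrow> indicator (cball 0 r) z * (F z * cnj z ^ m)"
      unfolding s_def using F
      by (intro AE_I2 tendsto_intros) (simp add: disc_series_def sums_def)
    show "AE z in area_measure. norm (s N z) \<le> (\<Sum>k. norm (c k * complex_of_real r ^ k))" for N
    proof (rule AE_I2)
      fix z assume "z \<in> space area_measure"
      then have z: "z \<in> unit_disc" by simp
      show "norm (s N z) \<le> (\<Sum>k. norm (c k * complex_of_real r ^ k))"
      proof (cases "cmod z \<le> r")
        case True
        have "norm (s N z) = norm (\<Sum>k<N. c k * z ^ k) * cmod z ^ m"
          using True by (simp add: s_def norm_mult norm_power)
        also have "\<dots> \<le> norm (\<Sum>k<N. c k * z ^ k)"
          using cmod_power_le_one[OF z] by (intro mult_left_le) auto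
        also have "\<dots> \<le> (\<Sum>k<N. norm (c k * complex_of_real r ^ k))"
          using True r by (intro sum_norm_le) (auto simp: norm_mult norm_power intro!: mult_left_mono power_mono)
        also have "\<dots> \<le> (\<Sum>k. norm (c k * complex_of_real r ^ k))"
          by (rule sum_le_suminf[OF abs_sum]) auto
        finally show ?thesis .
      next
        case False
        then show ?thesis using suminf_nonneg[OF abs_sum] by (simp add: s_def)
      qed
    qed
  qed simp
  moreover have "(LINT z|area_measure. s N z) = c m * complex_of_real (r ^ (2 * m + 2) / (m + 1))" if "N > m" for N
  proof -
    have int: "integrable area_measure (\<lambda>z. c k * (indicator (cball 0 r) z * (z ^ k * cnj z ^ m)))" for k
    proof (rule integrable_area_measure_bounded[where B = "cmod (c k)"])
      show "(\<lambda>z. c k * (indicator (cball 0 r) z * (z ^ k * cnj z ^ m))) \<in> borel_measurable area_measure"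
        by (intro borel_measurable_times borel_measurable_area_measure_of_borel[OF ind]
          borel_measurable_area_measure_of_continuous continuous_intros)
      fix z assume z: "z \<in> unit_disc"
      show "norm (c k * (indicator (cball 0 r) z * (z ^ k * cnj z ^ m))) \<le> cmod (c k)"
        using cmod_power_le_one[OF z]
        by (auto simp: norm_mult norm_power indicator_def intro!: mult_left_le mult_le_one)
    qed
    have "(LINT z|area_measure. s N z) =
        (LINT z|area_measure. (\<Sum>k<N. c k * (indicator (cball 0 r) z * (z ^ k * cnj z ^ m))))"
      by (intro arg_cong[of _ _ "integral\<^sup>L area_measure"] ext)
         (simp add: s_def sum_distrib_left sum_distrib_right mult_ac)
    also have "\<dots> = (\<Sum>k<N. c k * (LINT z|area_measure. indicator (cball 0 r) z * (z ^ k * cnj z ^ m)))"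
      using int by (subst Bochner_Integration.integral_sum) auto
    also have "\<dots> = (\<Sum>k<N. if k = m then c m * complex_of_real (r ^ (2 * m + 2) / (m + 1)) else 0)"
      using r by (intro sum.cong refl) (subst integral_area_measure_monomials; auto)
    also have "\<dots> = c m * complex_of_real (r ^ (2 * m + 2) / (m + 1))"
      using that by simp
    finally show ?thesis .
  qed
  then have "(\<lambda>N. LINT z|area_measure. s N z) \<longlonglongrightarrow> c m * complex_of_real (r ^ (2 * m + 2) / (m + 1))"
    by (intro tendsto_eventually eventually_sequentiallyI[of "Suc m"]) auto
  ultimately show ?thesis by (rule LIMSEQ_unique)
qed

text \<open>
  The cutoff radius tends to \<open>1\<close>, with \<open>\<bar>F\<bar>\<close> as the dominating function.
\<close>

lemma integral_against_monomial:
  assumes F: "disc_series c F" and int: "integrable area_measure F"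
  shows "(LINT z|area_measure. F z * cnj z ^ m) = c m / (m + 1)"
proof -
  define r where "r N = 1 - inverse (real (Suc N))" for N
  have r: "0 \<le> r N" "r N < 1" for N by (auto simp: r_def inverse_eq_divide)
  have r_lim: "r \<longlonglongrightarrow> 1"
    unfolding r_def using tendsto_diff[OF tendsto_const LIMSEQ_inverse_real_of_nat, of 1] by simp
  have ind: "indicator (cball 0 (r N)) \<in> borel_measurable (borel :: complex measure)" for N
    by (intro borel_measurable_indicator) simp
  have meas: "F \<in> borel_measurable area_measure" using int by auto
  have "(\<lambda>N. LINT z|area_measure. indicator (cball 0 (r N)) z * (F z * cnj z ^ m)) \<longlonglongrightarrow>
      (LINT z|area_measure. F z * cnj z ^ m)"
  proof (rule integral_dominated_convergence[where w = "\<lambda>z. cmod (F z)"])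
    show Fm: "(\<lambda>z. F z * cnj z ^ m) \<in> borel_measurable area_measure"
      by (intro borel_measurable_times meas
          borel_measurable_area_measure_of_continuous continuous_intros)
    show "(\<lambda>z. indicator (cball 0 (r N)) z * (F z * cnj z ^ m)) \<in> borel_measurable area_measure" for N
      by (rule borel_measurable_times[OF borel_measurable_area_measure_of_borel[OF ind] Fm])
    show "integrable area_measure (\<lambda>z. cmod (F z))" using int by simp
    show "AE z in area_measure. (\<lambda>N. indicator (cball 0 (r N)) z * (F z * cnj z ^ m)) \<longlonglongrightarrow> F z * cnj z ^ m"
    proof (rule AE_I2)
      fix z assume "z \<in> space area_measure"
      then have "cmod z < 1" by simp
      with r_lim have "eventually (\<lambda>N. cmod z < r N) sequentially"
        by (rule order_tendstoD)
      then have "eventually (\<lambda>N. indicator (cball 0 (r N)) z * (F z * cnj z ^ m) = F z * cnj z ^ m) sequentially"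
        by eventually_elim simp
      then show "(\<lambda>N. indicator (cball 0 (r N)) z * (F z * cnj z ^ m)) \<longlonglongrightarrow> F z * cnj z ^ m"
        by (rule tendsto_eventually)
    qed
    show "AE z in area_measure. norm (indicator (cball 0 (r N)) z * (F z * cnj z ^ m)) \<le> cmod (F z)" for N
      using cmod_power_le_one by (intro AE_I2) (auto simp: indicator_def norm_mult norm_power intro!: mult_left_le)
  qed
  moreover have "(\<lambda>N. LINT z|area_measure. indicator (cball 0 (r N)) z * (F z * cnj z ^ m)) \<longlonglongrightarrow>
      c m * complex_of_real (1 ^ (2 * m + 2) / (m + 1))"
    unfolding truncated_coefficient_integral[OF F r] by (intro tendsto_intros r_lim) simp
  ultimately have "(LINT z|area_measure. F z * cnj z ^ m) = c m * complex_of_real (1 ^ (2 * m + 2) / (m + 1))"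
    by (rule LIMSEQ_unique)
  then show ?thesis by (simp add: field_simps)
qed

section \<open>Square integrable functions on the disc\<close>

lemma L2_disc_measurable: "f \<in> L2_disc \<Longrightarrow> f \<in> borel_measurable area_measure"
  and L2_disc_square_integrable: "f \<in> L2_disc \<Longrightarrow> integrable area_measure (\<lambda>z. (cmod (f z))\<^sup>2)"
  by (simp_all add: L2_disc_def)

lemma L2_discI:
  "f \<in> borel_measurable area_measure \<Longrightarrow> integrable area_measure (\<lambda>z. (cmod (f z))\<^sup>2) \<Longrightarrow> f \<in> L2_disc"
  by (simp add: L2_disc_def)

lemma borel_measurable_cnj:
  assumes "g \<in> borel_measurable M"
  shows "(\<lambda>z. cnj (g z)) \<in> borel_measurable M"
proof -
  have "continuous_on UNIV cnj" by (rule linear_continuous_on[OF bounded_linear_cnj])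
  then have "cnj \<in> borel_measurable borel" by (rule borel_measurable_continuous_onI)
  from measurable_compose[OF assms this] show ?thesis .
qed

lemma weighted_AM_GM:
  fixes a b \<epsilon> :: real
  assumes "\<epsilon> > 0"
  shows "a * b \<le> (\<epsilon> * a\<^sup>2 + b\<^sup>2 / \<epsilon>) / 2"
proof -
  have "0 \<le> (\<epsilon> * a - b)\<^sup>2 / \<epsilon>" using assms by simp
  also have "\<dots> = \<epsilon> * a\<^sup>2 + b\<^sup>2 / \<epsilon> - 2 * (a * b)"
    using assms by (simp add: field_simps power2_eq_square)
  finally show ?thesis by simp
qed

lemma L2_disc_integrable_mult_cnj:
  assumes f: "f \<in> L2_disc" and g: "g \<in> L2_disc"
  shows "integrable area_measure (\<lambda>z. f z * cnj (g z))"
proof (rule Bochner_Integration.integrable_bound)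
  show "integrable area_measure (\<lambda>z. (cmod (f z))\<^sup>2 + (cmod (g z))\<^sup>2)"
    using f g by (intro Bochner_Integration.integrable_add L2_disc_square_integrable)
  show "(\<lambda>z. f z * cnj (g z)) \<in> borel_measurable area_measure"
    using f g by (intro borel_measurable_times borel_measurable_cnj L2_disc_measurable)
  show "AE z in area_measure. norm (f z * cnj (g z)) \<le> norm ((cmod (f z))\<^sup>2 + (cmod (g z))\<^sup>2)"
  proof (rule AE_I2)
    fix z
    have "2 * (cmod (f z) * cmod (g z)) \<le> (cmod (f z))\<^sup>2 + (cmod (g z))\<^sup>2"
      using sum_squares_bound[of "cmod (f z)" "cmod (g z)"] by simp
    moreover have "0 \<le> cmod (f z) * cmod (g z)" by simp
    ultimately have "cmod (f z) * cmod (g z) \<le> (cmod (f z))\<^sup>2 + (cmod (g z))\<^sup>2" by linarith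
    then show "norm (f z * cnj (g z)) \<le> norm ((cmod (f z))\<^sup>2 + (cmod (g z))\<^sup>2)"
      by (simp add: norm_mult)
  qed
qed

lemma L2_disc_bounded_mult:
  assumes f: "f \<in> L2_disc" and b: "b \<in> borel_measurable area_measure"
    and B: "\<And>z. z \<in> unit_disc \<Longrightarrow> cmod (b z) \<le> B"
  shows "(\<lambda>z. b z * f z) \<in> L2_disc"
proof (rule L2_discI)
  show meas: "(\<lambda>z. b z * f z) \<in> borel_measurable area_measure"
    by (intro borel_measurable_times b L2_disc_measurable f)
  show "integrable area_measure (\<lambda>z. (cmod (b z * f z))\<^sup>2)"
  proof (rule Bochner_Integration.integrable_bound)
    show "integrable area_measure (\<lambda>z. B\<^sup>2 * (cmod (f z))\<^sup>2)"
      by (intro integrable_mult_right L2_disc_square_integrable f)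
    show "(\<lambda>z. (cmod (b z * f z))\<^sup>2) \<in> borel_measurable area_measure"
      by (intro borel_measurable_power measurable_compose[OF meas borel_measurable_norm])
    show "AE z in area_measure. norm ((cmod (b z * f z))\<^sup>2) \<le> norm (B\<^sup>2 * (cmod (f z))\<^sup>2)"
    proof (rule AE_I2)
      fix z assume "z \<in> space area_measure"
      then have "(cmod (b z))\<^sup>2 \<le> B\<^sup>2" using B by (intro power_mono) auto
      then show "norm ((cmod (b z * f z))\<^sup>2) \<le> norm (B\<^sup>2 * (cmod (f z))\<^sup>2)"
        by (simp add: norm_mult power_mult_distrib mult_right_mono)
    qed
  qed
qed

lemma L2_disc_one: "(\<lambda>_. 1) \<in> L2_disc"
  by (rule L2_discI) simp_all

lemma L2_disc_continuous_bounded: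
  assumes "continuous_on unit_disc b" "\<And>z. z \<in> unit_disc \<Longrightarrow> cmod (b z) \<le> B"
  shows "b \<in> L2_disc"
  using L2_disc_bounded_mult[OF L2_disc_one borel_measurable_area_measure_of_continuous[OF assms(1)] assms(2)]
  by simp

lemma L2_disc_monomial: "(\<lambda>z. z ^ k) \<in> L2_disc"
  by (rule L2_disc_continuous_bounded[of _ 1]) (intro continuous_intros, simp add: norm_power power_le_one)

lemma L2_disc_cmult: "f \<in> L2_disc \<Longrightarrow> (\<lambda>z. c * f z) \<in> L2_disc"
  by (rule L2_disc_bounded_mult[of _ _ "cmod c"]) simp_all

lemma L2_disc_add:
  assumes f: "f \<in> L2_disc" and g: "g \<in> L2_disc"
  shows "(\<lambda>z. f z + g z) \<in> L2_disc"
proof (rule L2_discI)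
  show meas: "(\<lambda>z. f z + g z) \<in> borel_measurable area_measure"
    by (intro borel_measurable_add L2_disc_measurable f g)
  show "integrable area_measure (\<lambda>z. (cmod (f z + g z))\<^sup>2)"
  proof (rule Bochner_Integration.integrable_bound)
    show "integrable area_measure (\<lambda>z. 2 * (cmod (f z))\<^sup>2 + 2 * (cmod (g z))\<^sup>2)"
      using f g by (intro Bochner_Integration.integrable_add integrable_mult_right L2_disc_square_integrable)
    show "(\<lambda>z. (cmod (f z + g z))\<^sup>2) \<in> borel_measurable area_measure"
      by (intro borel_measurable_power measurable_compose[OF meas borel_measurable_norm])
    show "AE z in area_measure. norm ((cmod (f z + g z))\<^sup>2) \<le> norm (2 * (cmod (f z))\<^sup>2 + 2 * (cmod (g z))\<^sup>2)"
    proof (rule AE_I2)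
      fix z
      have "(cmod (f z + g z))\<^sup>2 \<le> (cmod (f z) + cmod (g z))\<^sup>2"
        by (intro power_mono norm_triangle_ineq) simp
      also have "\<dots> = (cmod (f z))\<^sup>2 + (cmod (g z))\<^sup>2 + 2 * (cmod (f z) * cmod (g z))"
        by (simp add: power2_sum)
      also have "\<dots> \<le> 2 * (cmod (f z))\<^sup>2 + 2 * (cmod (g z))\<^sup>2"
        using sum_squares_bound[of "cmod (f z)" "cmod (g z)"] by simp
      finally show "norm ((cmod (f z + g z))\<^sup>2) \<le> norm (2 * (cmod (f z))\<^sup>2 + 2 * (cmod (g z))\<^sup>2)"
        by simp
    qed
  qed
qed

lemma L2_disc_diff:
  assumes "f \<in> L2_disc" "g \<in> L2_disc"
  shows "(\<lambda>z. f z - g z) \<in> L2_disc"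
  using L2_disc_add[OF assms(1) L2_disc_cmult[OF assms(2), of "- 1"]] by simp

lemma L2_disc_zero: "(\<lambda>_. 0) \<in> L2_disc"
  using L2_disc_cmult[OF L2_disc_one, of 0] by simp

lemma L2_disc_sum:
  assumes "\<And>i. i \<in> I \<Longrightarrow> f i \<in> L2_disc"
  shows "(\<lambda>z. \<Sum>i\<in>I. f i z) \<in> L2_disc"
  using assms
proof (induction I rule: infinite_finite_induct)
  case (insert i I)
  then show ?case using L2_disc_add[of "f i" "\<lambda>z. \<Sum>i\<in>I. f i z"] by simp
qed (simp_all add: L2_disc_zero)

lemma L2_disc_cong:
  assumes "f \<in> L2_disc" "\<And>z. z \<in> unit_disc \<Longrightarrow> f z = g z"
  shows "g \<in> L2_disc"
proof -
  have "f \<in> borel_measurable area_measure \<longleftrightarrow> g \<in> borel_measurable area_measure"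
    by (intro measurable_cong) (simp add: assms(2))
  moreover have "integrable area_measure (\<lambda>z. (cmod (f z))\<^sup>2) \<longleftrightarrow> integrable area_measure (\<lambda>z. (cmod (g z))\<^sup>2)"
    by (intro Bochner_Integration.integrable_cong refl) (simp add: assms(2))
  ultimately show ?thesis using assms(1) by (simp add: L2_disc_def)
qed

lemma L2_inner_cong:
  assumes "\<And>z. z \<in> unit_disc \<Longrightarrow> f z = f' z" "\<And>z. z \<in> unit_disc \<Longrightarrow> g z = g' z"
  shows "L2_inner f g = L2_inner f' g'"
  unfolding L2_inner_def using assms by (intro Bochner_Integration.integral_cong refl) simp

lemma L2_inner_diff_left:
  assumes "f \<in> L2_disc" "g \<in> L2_disc" "h \<in> L2_disc"
  shows "L2_inner (\<lambda>z. f z - g z) h = L2_inner f h - L2_inner g h"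
  unfolding L2_inner_def left_diff_distrib
  by (intro Bochner_Integration.integral_diff L2_disc_integrable_mult_cnj assms)

lemma L2_inner_diff_right:
  assumes "f \<in> L2_disc" "g \<in> L2_disc" "h \<in> L2_disc"
  shows "L2_inner h (\<lambda>z. f z - g z) = L2_inner h f - L2_inner h g"
  unfolding L2_inner_def complex_cnj_diff right_diff_distrib
  by (intro Bochner_Integration.integral_diff L2_disc_integrable_mult_cnj assms)

lemma L2_inner_sum_left:
  assumes "\<And>i. i \<in> I \<Longrightarrow> f i \<in> L2_disc" "h \<in> L2_disc"
  shows "L2_inner (\<lambda>z. \<Sum>i\<in>I. f i z) h = (\<Sum>i\<in>I. L2_inner (f i) h)"
  unfolding L2_inner_def sum_distrib_right
  by (intro Bochner_Integration.integral_sum L2_disc_integrable_mult_cnj assms)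

lemma L2_inner_sum_right:
  assumes "\<And>i. i \<in> I \<Longrightarrow> f i \<in> L2_disc" "h \<in> L2_disc"
  shows "L2_inner h (\<lambda>z. \<Sum>i\<in>I. f i z) = (\<Sum>i\<in>I. L2_inner h (f i))"
  unfolding L2_inner_def cnj_sum sum_distrib_left
  by (intro Bochner_Integration.integral_sum L2_disc_integrable_mult_cnj assms)

lemma L2_inner_cmult_right: "L2_inner h (\<lambda>z. c * f z) = cnj c * L2_inner h f"
  unfolding L2_inner_def complex_cnj_mult mult.left_commute[of _ "cnj c"]
  by (rule integral_mult_right_zero)

lemma L2_inner_commute: "L2_inner g f = cnj (L2_inner f g)"
proof -
  have "(\<lambda>z. g z * cnj (f z)) = (\<lambda>z. cnj (f z * cnj (g z)))" by (simp add: mult.commute)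
  then show ?thesis unfolding L2_inner_def by (simp only: Bochner_Integration.integral_cnj)
qed

lemma L2_inner_self: "L2_inner f f = complex_of_real (LINT z|area_measure. (cmod (f z))\<^sup>2)"
  unfolding L2_inner_def complex_norm_square[symmetric] by (rule integral_complex_of_real)

text \<open>
  A form of the Cauchy-Schwarz inequality without square roots: it still shows that the inner product
  tends to \<open>0\<close> when \<open>g\<close> does, by passing to the limit first for fixed \<open>\<epsilon>\<close> and then letting \<open>\<epsilon>\<close> tend to \<open>0\<close>.
\<close>

lemma L2_inner_weighted_bound:
  assumes f: "f \<in> L2_disc" and g: "g \<in> L2_disc" and \<epsilon>: "\<epsilon> > 0"
  shows "cmod (L2_inner f g) \<le>
    (\<epsilon> * (LINT z|area_measure. (cmod (f z))\<^sup>2) + (LINT z|area_measure. (cmod (g z))\<^sup>2) / \<epsilon>) / 2"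
proof -
  have "cmod (L2_inner f g) \<le> (LINT z|area_measure. cmod (f z * cnj (g z)))"
    unfolding L2_inner_def by (rule integral_norm_bound)
  also have "\<dots> \<le> (LINT z|area_measure. (\<epsilon> * (cmod (f z))\<^sup>2 + (cmod (g z))\<^sup>2 / \<epsilon>) / 2)"
  proof (rule integral_mono)
    show "integrable area_measure (\<lambda>z. cmod (f z * cnj (g z)))"
      by (intro integrable_norm L2_disc_integrable_mult_cnj f g)
    show "integrable area_measure (\<lambda>z. (\<epsilon> * (cmod (f z))\<^sup>2 + (cmod (g z))\<^sup>2 / \<epsilon>) / 2)"
      by (intro integrable_divide Bochner_Integration.integrable_add integrable_mult_right
          L2_disc_square_integrable f g)
    show "cmod (f z * cnj (g z)) \<le> (\<epsilon> * (cmod (f z))\<^sup>2 + (cmod (g z))\<^sup>2 / \<epsilon>) / 2" for z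
      using weighted_AM_GM[OF \<epsilon>] by (simp add: norm_mult)
  qed
  also have "\<dots> = (\<epsilon> * (LINT z|area_measure. (cmod (f z))\<^sup>2) + (LINT z|area_measure. (cmod (g z))\<^sup>2) / \<epsilon>) / 2"
    using L2_disc_square_integrable[OF f] L2_disc_square_integrable[OF g] by simp
  finally show ?thesis .
qed

section \<open>Orthogonality and coefficients in the Bergman space\<close>

lemma L2_inner_monomial:
  assumes F: "F \<in> L2_disc" "disc_series c F"
  shows "L2_inner F (\<lambda>z. z ^ m) = c m / (m + 1)"
proof -
  have "integrable area_measure F"
    using L2_disc_integrable_mult_cnj[OF F(1) L2_disc_one] by simp
  then show ?thesis
    using integral_against_monomial[OF F(2)] by (simp add: L2_inner_def)
qed

lemma L2_disc_polynomial: "(\<lambda>z. \<Sum>k<N. c k * z ^ k) \<in> L2_disc"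
  by (intro L2_disc_sum L2_disc_cmult L2_disc_monomial)

lemma disc_series_polynomial:
  "disc_series (\<lambda>k. if k < N then c k else 0) (\<lambda>z. \<Sum>k<N. c k * z ^ k)"
  unfolding disc_series_def
proof
  fix z :: complex
  have "(\<lambda>k. if k \<in> {..<N} then c k * z ^ k else 0) sums (\<Sum>k\<in>{..<N}. c k * z ^ k)"
    by (rule sums_If_finite_set) simp
  also have "(\<lambda>k. if k \<in> {..<N} then c k * z ^ k else 0) = (\<lambda>k. (if k < N then c k else 0) * z ^ k)"
    by auto
  finally show "(\<lambda>k. (if k < N then c k else 0) * z ^ k) sums (\<Sum>k<N. c k * z ^ k)" .
qed

lemma L2_inner_polynomial_right:
  assumes "h \<in> L2_disc"
  shows "L2_inner h (\<lambda>z. \<Sum>k<N. c k * z ^ k) = (\<Sum>k<N. cnj (c k) * L2_inner h (\<lambda>z. z ^ k))"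
  using assms
  by (simp add: L2_inner_sum_right L2_disc_cmult L2_disc_monomial L2_inner_cmult_right)

text \<open>
  Allowing the coefficients of \<open>F\<close> to differ from \<open>c\<close> beyond \<open>N\<close> covers two cases at once: \<open>F\<close> with its own
  partial sum, and the partial sum with itself.
\<close>

lemma L2_inner_own_partial_sum:
  assumes F: "F \<in> L2_disc" "disc_series d F" and d: "\<And>k. k < N \<Longrightarrow> d k = c k"
  shows "L2_inner F (\<lambda>z. \<Sum>k<N. c k * z ^ k) = complex_of_real (\<Sum>k<N. (cmod (c k))\<^sup>2 / (k + 1))"
proof -
  have "cnj (c k) * (c k / of_nat (k + 1)) = complex_of_real ((cmod (c k))\<^sup>2 / real (k + 1))" for k
    by (simp only: of_real_divide complex_norm_square of_real_of_nat_eq) (simp add: mult.commute)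
  then show ?thesis
    unfolding L2_inner_polynomial_right[OF F(1)] L2_inner_monomial[OF F] of_real_sum
    by (intro sum.cong refl) (simp add: d)
qed

lemma square_integral_polynomial:
  "(LINT z|area_measure. (cmod (\<Sum>k<N. c k * z ^ k))\<^sup>2) = (\<Sum>k<N. (cmod (c k))\<^sup>2 / (k + 1))"
proof -
  have "complex_of_real (LINT z|area_measure. (cmod (\<Sum>k<N. c k * z ^ k))\<^sup>2) =
      complex_of_real (\<Sum>k<N. (cmod (c k))\<^sup>2 / (k + 1))"
    unfolding L2_inner_self[symmetric]
    by (rule L2_inner_own_partial_sum[OF L2_disc_polynomial disc_series_polynomial]) simp
  then show ?thesis by (simp only: of_real_eq_iff)
qed

text \<open>
  Bessel's inequality, from \<open>0 \<le> \<parallel>F - S\<parallel>\<^sup>2 = \<parallel>F\<parallel>\<^sup>2 - \<parallel>S\<parallel>\<^sup>2\<close> for a partial sum \<open>S\<close>.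
\<close>

lemma bessel_disc_series:
  assumes F: "F \<in> L2_disc" "disc_series c F"
  shows "(\<Sum>k<N. (cmod (c k))\<^sup>2 / (k + 1)) \<le> (LINT z|area_measure. (cmod (F z))\<^sup>2)"
proof -
  define S where "S = (\<lambda>z. \<Sum>k<N. c k * z ^ k)"
  define q where "q = (\<Sum>k<N. (cmod (c k))\<^sup>2 / (k + 1))"
  have S: "S \<in> L2_disc" unfolding S_def by (rule L2_disc_polynomial)
  have FS: "L2_inner F S = complex_of_real q"
    unfolding S_def q_def by (rule L2_inner_own_partial_sum[OF F]) simp
  then have SF: "L2_inner S F = complex_of_real q"
    using L2_inner_commute[of S F] by simp
  have SS: "L2_inner S S = complex_of_real q"
    unfolding S_def q_def
    by (rule L2_inner_own_partial_sum[OF L2_disc_polynomial disc_series_polynomial]) simp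
  have "L2_inner (\<lambda>z. F z - S z) (\<lambda>z. F z - S z) = L2_inner F F - complex_of_real q"
    using F(1) S by (simp add: L2_inner_diff_left L2_inner_diff_right L2_disc_diff FS SF SS)
  then have "(LINT z|area_measure. (cmod (F z - S z))\<^sup>2) = (LINT z|area_measure. (cmod (F z))\<^sup>2) - q"
    unfolding L2_inner_self by (simp only: of_real_eq_iff of_real_diff[symmetric])
  moreover have "0 \<le> (LINT z|area_measure. (cmod (F z - S z))\<^sup>2)"
    by (rule Bochner_Integration.integral_nonneg) simp
  ultimately show ?thesis by (simp add: q_def)
qed

lemma summable_disc_series_L2:
  assumes F: "F \<in> L2_disc" "disc_series c F"
  shows "summable (\<lambda>k. (cmod (c k))\<^sup>2 / real (k + 1))"
proof (rule bounded_imp_summable)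
  show "(\<Sum>k\<le>N. (cmod (c k))\<^sup>2 / real (k + 1)) \<le> (LINT z|area_measure. (cmod (F z))\<^sup>2)" for N
    using bessel_disc_series[OF F, of "Suc N"] by (simp only: lessThan_Suc_atMost)
qed simp

text \<open>
  The converse of Bessel's inequality: the partial sums converge pointwise on the disc and have squared
  norms bounded by the sum, so Fatou's lemma applies.
\<close>

lemma L2_disc_of_summable:
  assumes F: "disc_series c F" and c: "summable (\<lambda>k. (cmod (c k))\<^sup>2 / real (k + 1))"
  shows "F \<in> L2_disc"
    and "(LINT z|area_measure. (cmod (F z))\<^sup>2) \<le> (\<Sum>k. (cmod (c k))\<^sup>2 / real (k + 1))"
proof -
  let ?s = "\<Sum>k. (cmod (c k))\<^sup>2 / real (k + 1)"
  define S where "S N z = (\<Sum>k<N. c k * z ^ k)" for N z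
  have S: "S N \<in> L2_disc" for N unfolding S_def by (rule L2_disc_polynomial)
  have s0: "0 \<le> ?s" by (rule suminf_nonneg[OF c]) simp
  have "continuous_on unit_disc F"
    using disc_series_holomorphic[OF F] by (rule holomorphic_on_imp_continuous_on)
  then have meas: "F \<in> borel_measurable area_measure"
    by (rule borel_measurable_area_measure_of_continuous)
  have square_meas: "(\<lambda>z. (cmod (F z))\<^sup>2) \<in> borel_measurable area_measure"
    by (intro borel_measurable_power measurable_compose[OF meas borel_measurable_norm])
  have "(\<integral>\<^sup>+z. ennreal ((cmod (F z))\<^sup>2) \<partial>area_measure) =
      (\<integral>\<^sup>+z. liminf (\<lambda>N. ennreal ((cmod (S N z))\<^sup>2)) \<partial>area_measure)"
  proof (rule nn_integral_cong)
    fix z assume "z \<in> space area_measure"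
    then have "(\<lambda>N. S N z) \<longlonglongrightarrow> F z"
      using F by (simp add: disc_series_def sums_def S_def)
    then have "(\<lambda>N. ennreal ((cmod (S N z))\<^sup>2)) \<longlonglongrightarrow> ennreal ((cmod (F z))\<^sup>2)"
      by (intro tendsto_ennrealI tendsto_power tendsto_norm)
    then show "ennreal ((cmod (F z))\<^sup>2) = liminf (\<lambda>N. ennreal ((cmod (S N z))\<^sup>2))"
      by (intro lim_imp_Liminf[symmetric]) simp_all
  qed
  also have "\<dots> \<le> liminf (\<lambda>N. \<integral>\<^sup>+z. ennreal ((cmod (S N z))\<^sup>2) \<partial>area_measure)"
    using L2_disc_square_integrable[OF S, THEN borel_measurable_integrable]
    by (intro nn_integral_liminf measurable_compose[OF _ measurable_ennreal])
  also have "\<dots> \<le> ennreal ?s"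
  proof (rule Liminf_le)
    have "(\<integral>\<^sup>+z. ennreal ((cmod (S N z))\<^sup>2) \<partial>area_measure) \<le> ennreal ?s" for N
    proof -
      have "(\<integral>\<^sup>+z. ennreal ((cmod (S N z))\<^sup>2) \<partial>area_measure) = ennreal (LINT z|area_measure. (cmod (S N z))\<^sup>2)"
        by (rule nn_integral_eq_integral[OF L2_disc_square_integrable[OF S]]) simp
      also have "\<dots> = ennreal (\<Sum>k<N. (cmod (c k))\<^sup>2 / real (k + 1))"
        unfolding S_def square_integral_polynomial ..
      also have "\<dots> \<le> ennreal ?s"
        by (intro ennreal_leI sum_le_suminf[OF c]) auto
      finally show ?thesis .
    qed
    then show "\<forall>\<^sub>F N in sequentially. (\<integral>\<^sup>+z. ennreal ((cmod (S N z))\<^sup>2) \<partial>area_measure) \<le> ennreal ?s"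
      by (intro always_eventually allI)
  qed simp
  finally have le: "(\<integral>\<^sup>+z. ennreal ((cmod (F z))\<^sup>2) \<partial>area_measure) \<le> ennreal ?s" .
  have int: "integrable area_measure (\<lambda>z. (cmod (F z))\<^sup>2)"
    by (rule integrableI_bounded[OF square_meas])
       (use le in \<open>simp add: le_less_trans[OF _ ennreal_less_top]\<close>)
  then show "F \<in> L2_disc" by (rule L2_discI[OF meas])
  have "ennreal (LINT z|area_measure. (cmod (F z))\<^sup>2) \<le> ennreal ?s"
    using le nn_integral_eq_integral[OF int] by simp
  then show "(LINT z|area_measure. (cmod (F z))\<^sup>2) \<le> ?s"
    using s0 by (simp add: ennreal_le_iff)
qed

text \<open>
  The remainder \<open>F - S\<close> has the coefficients of \<open>F\<close> with the first \<open>N\<close> deleted, so the preceding bound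
  estimates its norm by the tail of a convergent series.
\<close>

lemma partial_sums_L2_converge:
  assumes F: "F \<in> L2_disc" "disc_series c F"
  shows "(\<lambda>N. LINT z|area_measure. (cmod (F z - (\<Sum>k<N. c k * z ^ k)))\<^sup>2) \<longlonglongrightarrow> 0"
proof -
  let ?w = "\<lambda>k. (cmod (c k))\<^sup>2 / real (k + 1)"
  have sum_c: "summable ?w" by (rule summable_disc_series_L2[OF F])
  have bound: "(LINT z|area_measure. (cmod (F z - (\<Sum>k<N. c k * z ^ k)))\<^sup>2) \<le> (\<Sum>k. ?w k) - (\<Sum>k<N. ?w k)" for N
  proof -
    define d where "d k = (if k < N then 0 else c k)" for k
    have "disc_series d (\<lambda>z. F z - (\<Sum>k<N. c k * z ^ k))"
      unfolding disc_series_def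
    proof
      fix z :: complex assume z: "z \<in> unit_disc"
      have "(\<lambda>k. c k * z ^ k - (if k < N then c k else 0) * z ^ k) sums (F z - (\<Sum>k<N. c k * z ^ k))"
        using F(2) disc_series_polynomial[of N c] z by (intro sums_diff) (simp_all add: disc_series_def)
      also have "(\<lambda>k. c k * z ^ k - (if k < N then c k else 0) * z ^ k) = (\<lambda>k. d k * z ^ k)"
        by (auto simp: d_def)
      finally show "(\<lambda>k. d k * z ^ k) sums (F z - (\<Sum>k<N. c k * z ^ k))" .
    qed
    moreover have d_sums: "(\<lambda>k. (cmod (d k))\<^sup>2 / real (k + 1)) sums ((\<Sum>k. ?w k) - (\<Sum>k<N. ?w k))"
    proof -
      have "(\<lambda>k. ?w k - (if k \<in> {..<N} then ?w k else 0)) sums ((\<Sum>k. ?w k) - (\<Sum>k<N. ?w k))"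
        by (intro sums_diff summable_sums[OF sum_c] sums_If_finite_set) simp
      also have "(\<lambda>k. ?w k - (if k \<in> {..<N} then ?w k else 0)) = (\<lambda>k. (cmod (d k))\<^sup>2 / real (k + 1))"
        by (auto simp: d_def)
      finally show ?thesis .
    qed
    ultimately show ?thesis
      using L2_disc_of_summable(2) sums_summable[OF d_sums] sums_unique[OF d_sums] by simp
  qed
  show ?thesis
  proof (rule tendsto_sandwich[where f = "\<lambda>_. 0" and h = "\<lambda>N. (\<Sum>k. ?w k) - (\<Sum>k<N. ?w k)"])
    show "(\<lambda>N. (\<Sum>k. ?w k) - (\<Sum>k<N. ?w k)) \<longlonglongrightarrow> 0"
      using tendsto_diff[OF tendsto_const summable_LIMSEQ[OF sum_c], of "\<Sum>k. ?w k"] by simp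
    show "\<forall>\<^sub>F N in sequentially. 0 \<le> (LINT z|area_measure. (cmod (F z - (\<Sum>k<N. c k * z ^ k)))\<^sup>2)"
      by (intro always_eventually allI Bochner_Integration.integral_nonneg) simp
    show "\<forall>\<^sub>F N in sequentially. (LINT z|area_measure. (cmod (F z - (\<Sum>k<N. c k * z ^ k)))\<^sup>2)
        \<le> (\<Sum>k. ?w k) - (\<Sum>k<N. ?w k)"
      by (intro always_eventually allI bound)
  qed simp
qed

text \<open>
  The polynomials are dense in the Bergman space, because the Taylor polynomials of \<open>v\<close> converge to \<open>v\<close>
  in mean square.
\<close>

lemma orthogonal_to_bergman_space_iff:
  assumes w: "w \<in> L2_disc"
  shows "(\<forall>v\<in>bergman_space. L2_inner w v = 0) \<longleftrightarrow> (\<forall>m. L2_inner w (\<lambda>z. z ^ m) = 0)"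
proof (intro iffI ballI allI)
  fix m assume "\<forall>v\<in>bergman_space. L2_inner w v = 0"
  moreover have "(\<lambda>z. z ^ m) \<in> bergman_space"
    unfolding bergman_space_def using L2_disc_monomial by (auto intro!: holomorphic_intros)
  ultimately show "L2_inner w (\<lambda>z. z ^ m) = 0" by blast
next
  fix v assume mono: "\<forall>m. L2_inner w (\<lambda>z. z ^ m) = 0" and "v \<in> bergman_space"
  then have v: "v \<in> L2_disc" "v holomorphic_on unit_disc" by (auto simp: bergman_space_def)
  obtain c where c: "disc_series c v" using disc_series_of_holomorphic[OF v(2)] .
  define S where "S N z = (\<Sum>k<N. c k * z ^ k)" for N z
  define W where "W = (LINT z|area_measure. (cmod (w z))\<^sup>2)"
  define e where "e N = (LINT z|area_measure. (cmod (v z - S N z))\<^sup>2)" for N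
  have e: "e \<longlonglongrightarrow> 0"
    unfolding e_def S_def by (rule partial_sums_L2_converge[OF v(1) c])
  have S: "S N \<in> L2_disc" for N unfolding S_def by (rule L2_disc_polynomial)
  have inner_eq: "L2_inner w v = L2_inner w (\<lambda>z. v z - S N z)" for N
  proof -
    have "L2_inner w (S N) = 0"
      unfolding S_def L2_inner_polynomial_right[OF w] using mono by simp
    then show ?thesis using L2_inner_diff_right[OF v(1) S w] by simp
  qed
  have le: "cmod (L2_inner w v) \<le> (\<epsilon> * W + 0 / \<epsilon>) / 2" if "\<epsilon> > 0" for \<epsilon>
  proof (rule LIMSEQ_le_const)
    show "(\<lambda>N. (\<epsilon> * W + e N / \<epsilon>) / 2) \<longlonglongrightarrow> (\<epsilon> * W + 0 / \<epsilon>) / 2"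
      using that by (intro tendsto_intros e) auto
    have "cmod (L2_inner w v) \<le> (\<epsilon> * W + e N / \<epsilon>) / 2" for N
      using L2_inner_weighted_bound[OF w L2_disc_diff[OF v(1) S] that, of N]
      unfolding inner_eq[of N] W_def e_def .
    then show "\<exists>N0. \<forall>N\<ge>N0. cmod (L2_inner w v) \<le> (\<epsilon> * W + e N / \<epsilon>) / 2"
      by blast
  qed
  \<comment> \<open>The bound holds for every positive \<open>\<epsilon>\<close>, so it holds in the limit.\<close>
  have "((\<lambda>\<epsilon>. (\<epsilon> * W + 0 / \<epsilon>) / 2) \<longlongrightarrow> (0 * W + 0) / 2) (at_right 0)"
    by (intro tendsto_intros) auto
  moreover have "\<forall>\<^sub>F \<epsilon> in at_right 0. cmod (L2_inner w v) \<le> (\<epsilon> * W + 0 / \<epsilon>) / 2"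
    using eventually_at_right_less[of "0 :: real"] by (rule eventually_mono) (rule le)
  ultimately have "cmod (L2_inner w v) \<le> (0 * W + 0) / 2"
    by (rule tendsto_lowerbound) simp
  then show "L2_inner w v = 0" by simp
qed

text \<open>
  Coefficients for which the norm series converges grow slowly enough for the power series to converge
  in the disc, by \<open>\<bar>c\<^sub>k\<bar> \<bar>z\<bar>\<^sup>k \<le> \<bar>c\<^sub>k\<bar>\<^sup>2 / (k + 1) + (k + 1) \<bar>z\<bar>\<^bsup>2k\<^esup>\<close>.
\<close>

lemma bergman_function_of_coefficients:
  assumes c: "summable (\<lambda>k. (cmod (c k))\<^sup>2 / real (k + 1))"
  obtains u where "u \<in> bergman_space" "disc_series c u" "\<And>z. z \<notin> unit_disc \<Longrightarrow> u z = 0"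
proof
  define u where "u z = (if z \<in> unit_disc then \<Sum>k. c k * z ^ k else 0)" for z
  have "summable (\<lambda>k. c k * z ^ k)" if z: "z \<in> unit_disc" for z
  proof (rule summable_comparison_test')
    have "(cmod z)\<^sup>2 < 1" using z by (simp add: abs_square_less_1)
    then have "summable (\<lambda>k. real (Suc k) * ((cmod z)\<^sup>2) ^ k)"
      using geometric_deriv_sums[of "(cmod z)\<^sup>2"] by (auto intro: sums_summable)
    then show "summable (\<lambda>k. (cmod (c k))\<^sup>2 / real (k + 1) + real (Suc k) * ((cmod z)\<^sup>2) ^ k)"
      by (rule summable_add[OF c])
    fix k :: nat
    have half_le: "x / 2 \<le> x" if "0 \<le> x" for x :: real using that by simp
    have "cmod (c k) * cmod z ^ k \<le>
        ((1 / real (k + 1)) * (cmod (c k))\<^sup>2 + (cmod z ^ k)\<^sup>2 / (1 / real (k + 1))) / 2"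
      by (rule weighted_AM_GM) simp
    also have "\<dots> \<le> (1 / real (k + 1)) * (cmod (c k))\<^sup>2 + (cmod z ^ k)\<^sup>2 / (1 / real (k + 1))"
      by (rule half_le) simp
    also have "\<dots> = (cmod (c k))\<^sup>2 / real (k + 1) + real (Suc k) * ((cmod z)\<^sup>2) ^ k"
      by (simp add: power_mult[symmetric] mult.commute)
    finally show "norm (c k * z ^ k) \<le> (cmod (c k))\<^sup>2 / real (k + 1) + real (Suc k) * ((cmod z)\<^sup>2) ^ k"
      by (simp only: norm_mult norm_power)
  qed
  then show u: "disc_series c u"
    unfolding disc_series_def u_def by (auto intro: summable_sums)
  show "u \<in> bergman_space"
    using disc_series_holomorphic[OF u] L2_disc_of_summable(1)[OF u c] by (simp add: bergman_space_def)
  show "u z = 0" if "z \<notin> unit_disc" for z using that by (simp add: u_def)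
qed

section \<open>The Bergman projection\<close>

lemma bergman_spaceD:
  assumes "u \<in> bergman_space"
  shows "u holomorphic_on unit_disc" "u \<in> L2_disc"
  using assms by (simp_all add: bergman_space_def)

text \<open>
  Uniqueness: the inner products with the monomials determine all Taylor coefficients of a function
  in the Bergman space, and the values off the disc are prescribed.
\<close>

lemma bergman_projection_eqI:
  assumes h: "h \<in> L2_disc" and u: "u \<in> bergman_space" "\<And>z. z \<notin> unit_disc \<Longrightarrow> u z = 0"
    and orth: "\<And>v. v \<in> bergman_space \<Longrightarrow> L2_inner (\<lambda>z. h z - u z) v = 0"
  shows "bergman_projection h = u"
  unfolding bergman_projection_def
proof (rule the_equality)
  show "u \<in> bergman_space \<and> (\<forall>z. z \<notin> unit_disc \<longrightarrow> u z = 0) \<and>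
      (\<forall>v\<in>bergman_space. L2_inner (\<lambda>z. h z - u z) v = 0)"
    using assms by blast
next
  fix u' assume u': "u' \<in> bergman_space \<and> (\<forall>z. z \<notin> unit_disc \<longrightarrow> u' z = 0) \<and>
      (\<forall>v\<in>bergman_space. L2_inner (\<lambda>z. h z - u' z) v = 0)"
  have coeff: "d m / (m + 1) = L2_inner h (\<lambda>z. z ^ m)"
    if "w \<in> bergman_space" "disc_series d w" "\<And>v. v \<in> bergman_space \<Longrightarrow> L2_inner (\<lambda>z. h z - w z) v = 0" for w d m
  proof -
    have w: "w \<in> L2_disc" using that(1) by (rule bergman_spaceD)
    then have "L2_inner (\<lambda>z. h z - w z) (\<lambda>z. z ^ m) = 0"
      using orthogonal_to_bergman_space_iff[OF L2_disc_diff[OF h w]] that(3) by blast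
    then show ?thesis
      using L2_inner_diff_left[OF h w L2_disc_monomial] L2_inner_monomial[OF w that(2)] by simp
  qed
  obtain d where d: "disc_series d u"
    using disc_series_of_holomorphic bergman_spaceD(1)[OF u(1)] by blast
  obtain d' where d': "disc_series d' u'"
    using disc_series_of_holomorphic bergman_spaceD(1) u' by blast
  have "d m / (m + 1) = d' m / (m + 1)" for m
    using coeff[OF u(1) d orth] coeff[OF _ d'] u' by simp
  then have "d' = d" by (simp add: fun_eq_iff) (metis of_nat_Suc of_nat_neq_0)
  then have "u' z = u z" for z
    using disc_series_value_eq[of d u' u z] d d' u u' by (cases "z \<in> unit_disc") auto
  then show "u' = u" by blast
qed

text \<open>
  The weight \<open>(j + 1) / (j + i + 1) \<le> 1\<close> compensates the passage from \<open>1 / (j + i + 1)\<close> to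
  \<open>1 / (j + 1)\<close>: squared and divided by \<open>j + 1\<close> it is at most \<open>1 / (j + i + 1)\<close>.
\<close>

lemma summable_shifted_coefficients:
  fixes c :: "nat \<Rightarrow> nat \<Rightarrow> complex"
  assumes c: "\<And>i. i \<le> n \<Longrightarrow> summable (\<lambda>k. (cmod (c i k))\<^sup>2 / real (k + 1))"
  shows "summable (\<lambda>j. (cmod (\<Sum>i\<le>n. of_nat (j + 1) / of_nat (j + i + 1) * c i (j + i)))\<^sup>2 / real (j + 1))"
proof (rule summable_comparison_test')
  show "summable (\<lambda>j. real (n + 1) * (\<Sum>i\<le>n. (cmod (c i (j + i)))\<^sup>2 / real (j + i + 1)))"
    using c by (intro summable_mult summable_sum summable_ignore_initial_segment) auto
  fix j :: nat
  define t where "t i = of_nat (j + 1) / of_nat (j + i + 1) * c i (j + i)" for i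
  have t: "(cmod (t i))\<^sup>2 / real (j + 1) \<le> (cmod (c i (j + i)))\<^sup>2 / real (j + i + 1)" for i
  proof -
    have "(cmod (t i))\<^sup>2 / real (j + 1) =
        (real (j + 1) / real (j + i + 1)) * ((cmod (c i (j + i)))\<^sup>2 / real (j + i + 1))"
      unfolding t_def norm_mult norm_divide norm_of_nat
      by (simp add: power2_eq_square field_simps del: of_nat_add of_nat_Suc)
    also have "\<dots> \<le> (cmod (c i (j + i)))\<^sup>2 / real (j + i + 1)"
      by (intro mult_left_le_one_le) auto
    finally show ?thesis .
  qed
  have "(cmod (\<Sum>i\<le>n. t i))\<^sup>2 \<le> (\<Sum>i\<le>n. cmod (t i))\<^sup>2"
    by (intro power_mono norm_sum) simp
  also have "\<dots> \<le> real (n + 1) * (\<Sum>i\<le>n. (cmod (t i))\<^sup>2)"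
    using sum_squared_le_sum_of_squares[of "\<lambda>i. cmod (t i)" "{..n}"] by (simp add: mult.commute)
  finally have "(cmod (\<Sum>i\<le>n. t i))\<^sup>2 / real (j + 1) \<le> real (n + 1) * (\<Sum>i\<le>n. (cmod (t i))\<^sup>2) / real (j + 1)"
    by (intro divide_right_mono) simp_all
  also have "\<dots> = real (n + 1) * (\<Sum>i\<le>n. (cmod (t i))\<^sup>2 / real (j + 1))"
    by (simp only: sum_divide_distrib[symmetric] times_divide_eq_right)
  also have "\<dots> \<le> real (n + 1) * (\<Sum>i\<le>n. (cmod (c i (j + i)))\<^sup>2 / real (j + i + 1))"
    using t by (intro mult_left_mono sum_mono) auto
  finally show "norm ((cmod (\<Sum>i\<le>n. of_nat (j + 1) / of_nat (j + i + 1) * c i (j + i)))\<^sup>2 / real (j + 1))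
      \<le> real (n + 1) * (\<Sum>i\<le>n. (cmod (c i (j + i)))\<^sup>2 / real (j + i + 1))"
    by (simp add: t_def)
qed

lemma L2_disc_cnj_power_mult:
  assumes "f \<in> L2_disc"
  shows "(\<lambda>z. cnj z ^ i * f z) \<in> L2_disc"
proof (rule L2_disc_bounded_mult[OF assms])
  show "(\<lambda>z. cnj z ^ i) \<in> borel_measurable area_measure"
    by (intro borel_measurable_area_measure_of_continuous continuous_intros)
  show "cmod (cnj z ^ i) \<le> 1" if "z \<in> unit_disc" for z
    using that by (simp add: norm_power power_le_one)
qed

text \<open>
  Existence of the projection and its coefficients in one step: the candidate is the function with the
  coefficients forced by testing against monomials, \<open>\<langle>cnj z\<^sup>i b\<^sub>i, z\<^sup>m\<rangle> = \<langle>b\<^sub>i, z\<^bsup>m+i\<^esup>\<rangle>\<close>.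
\<close>

lemma bergman_projection_antianalytic_polynomial:
  assumes b: "\<And>i. i \<le> n \<Longrightarrow> b i \<in> bergman_space" "\<And>i. i \<le> n \<Longrightarrow> disc_series (c i) (b i)"
    and h: "\<And>z. z \<in> unit_disc \<Longrightarrow> h z = (\<Sum>i\<le>n. cnj z ^ i * b i z)"
  shows "disc_series (\<lambda>j. \<Sum>i\<le>n. of_nat (j + 1) / of_nat (j + i + 1) * c i (j + i)) (bergman_projection h)"
proof -
  define T where "T j = (\<Sum>i\<le>n. of_nat (j + 1) / of_nat (j + i + 1) * c i (j + i))" for j
  have bL: "b i \<in> L2_disc" if "i \<le> n" for i using bergman_spaceD(2)[OF b(1)[OF that]] .
  have terms: "(\<lambda>z. cnj z ^ i * b i z) \<in> L2_disc" if "i \<in> {..n}" for i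
    using that bL by (intro L2_disc_cnj_power_mult) auto
  have hL: "h \<in> L2_disc"
    by (rule L2_disc_cong[OF L2_disc_sum[OF terms]]) (simp_all add: h)
  have "summable (\<lambda>j. (cmod (T j))\<^sup>2 / real (j + 1))"
    unfolding T_def using bL b(2) by (intro summable_shifted_coefficients summable_disc_series_L2)
  then obtain u where u: "u \<in> bergman_space" "disc_series T u" "\<And>z. z \<notin> unit_disc \<Longrightarrow> u z = 0"
    by (rule bergman_function_of_coefficients) blast
  have uL: "u \<in> L2_disc" using u(1) by (rule bergman_spaceD)
  have "L2_inner (\<lambda>z. h z - u z) (\<lambda>z. z ^ m) = 0" for m
  proof -
    have "L2_inner h (\<lambda>z. z ^ m) = L2_inner (\<lambda>z. \<Sum>i\<le>n. cnj z ^ i * b i z) (\<lambda>z. z ^ m)"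
      by (rule L2_inner_cong) (simp_all add: h)
    also have "\<dots> = (\<Sum>i\<le>n. L2_inner (\<lambda>z. cnj z ^ i * b i z) (\<lambda>z. z ^ m))"
      by (rule L2_inner_sum_left[OF terms L2_disc_monomial])
    also have "\<dots> = (\<Sum>i\<le>n. L2_inner (b i) (\<lambda>z. z ^ (m + i)))"
      by (simp add: L2_inner_def power_add mult_ac)
    also have "\<dots> = (\<Sum>i\<le>n. c i (m + i) / (m + i + 1))"
      using L2_inner_monomial[OF bL b(2)] by (intro sum.cong refl) simp
    also have "\<dots> = T m / (m + 1)"
      unfolding T_def sum_divide_distrib
      by (intro sum.cong refl) (simp add: field_simps del: of_nat_add of_nat_Suc)
    also have "\<dots> = L2_inner u (\<lambda>z. z ^ m)"
      by (rule L2_inner_monomial[OF uL u(2), symmetric])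
    finally show ?thesis
      using L2_inner_diff_left[OF hL uL L2_disc_monomial] by simp
  qed
  then have "bergman_projection h = u"
    using orthogonal_to_bergman_space_iff[OF L2_disc_diff[OF hL uL]]
    by (intro bergman_projection_eqI[OF hL u(1) u(3)]) auto
  with u(2) show ?thesis by (simp only: T_def[abs_def])
qed

section \<open>Comparison of coefficients\<close>

text \<open>
  Both sides of the claimed identity, multiplied by \<open>j + i + 1\<close>, are the product of all \<open>j + k\<close> with
  \<open>1 \<le> k \<le> n + 1\<close>.
\<close>

lemma D_op_factor:
  assumes "i \<le> n"
  shows "(\<Prod>k=i+2..n+1. of_nat (j + k)) * (\<Prod>l=1..i. of_nat (j + l)) =
    (\<Prod>k=2..n+1. of_nat (j + k)) * (of_nat (j + 1) / of_nat (j + i + 1) :: complex)"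
proof -
  let ?p = "\<lambda>k. of_nat (j + k) :: complex"
  have "(\<Prod>k=1..n+1. ?p k) = (\<Prod>k=1..i. ?p k) * (\<Prod>k=i+1..n+1. ?p k)"
    using assms prod.ub_add_nat[of 1 i ?p "n + 1 - i"] by simp
  also have "(\<Prod>k=i+1..n+1. ?p k) = ?p (i + 1) * (\<Prod>k=i+2..n+1. ?p k)"
    using assms by (subst prod.atLeast_Suc_atMost) auto
  finally have "(\<Prod>k=1..n+1. ?p k) = ?p (i + 1) * ((\<Prod>k=i+2..n+1. ?p k) * (\<Prod>k=1..i. ?p k))"
    by (simp only: mult_ac)
  moreover have "(\<Prod>k=1..n+1. ?p k) = ?p 1 * (\<Prod>k=2..n+1. ?p k)"
    by (subst prod.atLeast_Suc_atMost) (auto simp: numeral_2_eq_2)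
  moreover have "?p (i + 1) \<noteq> 0" unfolding of_nat_eq_0_iff by simp
  ultimately show ?thesis by (simp add: field_simps del: of_nat_add of_nat_Suc prod.cl_ivl_Suc)
qed

text \<open>
  The common factor \<open>(j + 2) \<dots> (j + n + 1)\<close> is the one by which the operator applied to \<open>g\<close> acts, and
  what remains is the coefficient of the Bergman projection.
\<close>

lemma disc_series_D_op:
  assumes c: "\<And>i. i \<le> n \<Longrightarrow> disc_series (c i) (\<lambda>z. a i z * f z)"
  shows "disc_series (\<lambda>j. (\<Prod>k=2..n+1. of_nat (j + k)) *
      (\<Sum>i\<le>n. of_nat (j + 1) / of_nat (j + i + 1) * c i (j + i))) (D_op n a f)"
proof -
  define t where "t i j = (\<Prod>k=i+2..n+1. of_nat (j + k)) * ((\<Prod>l=1..i. of_nat (j + l)) * c i (j + i))"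
    for i j
  define G where "G i = zD_prod (i + 2) (n + 1) ((deriv ^^ i) (\<lambda>w. a i w * f w))" for i
  have G: "disc_series (t i) (G i)" if "i \<in> {..n}" for i
    unfolding t_def G_def using c that
    by (intro disc_series_zD_prod disc_series_funpow_deriv[of "c i"]) auto
  have "(\<lambda>z. \<Sum>i\<le>n. G i z) = D_op n a f"
    unfolding D_op_def G_def
    by (simp add: atMost_atLeast0 sum.atLeast_Suc_atMost numeral_2_eq_2 del: sum.cl_ivl_Suc)
  moreover have "(\<lambda>j. \<Sum>i\<le>n. t i j) = (\<lambda>j. (\<Prod>k=2..n+1. of_nat (j + k)) *
      (\<Sum>i\<le>n. of_nat (j + 1) / of_nat (j + i + 1) * c i (j + i)))"
  proof
    fix j
    have "t i j = (\<Prod>k=2..n+1. of_nat (j + k)) * (of_nat (j + 1) / of_nat (j + i + 1) * c i (j + i))"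
      if "i \<in> {..n}" for i
      unfolding t_def mult.assoc[symmetric] using that by (subst D_op_factor) auto
    then show "(\<Sum>i\<le>n. t i j) = (\<Prod>k=2..n+1. of_nat (j + k)) *
      (\<Sum>i\<le>n. of_nat (j + 1) / of_nat (j + i + 1) * c i (j + i))"
      unfolding sum_distrib_left by (intro sum.cong refl)
  qed
  ultimately show ?thesis
    using disc_series_sum[of "{..n}" t G, OF G] by (simp only:)
qed

lemma bergman_space_Hinf_mult:
  assumes a: "a \<in> Hinf_disc" and f: "f \<in> bergman_space"
  shows "(\<lambda>z. a z * f z) \<in> bergman_space"
proof -
  have hol: "a holomorphic_on unit_disc" using a by (simp add: Hinf_disc_def)
  obtain B where "\<forall>z\<in>unit_disc. cmod (a z) \<le> B"
    using a by (auto simp: Hinf_disc_def bounded_iff)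
  then have B: "cmod (a z) \<le> B" if "z \<in> unit_disc" for z using that by blast
  have "(\<lambda>z. a z * f z) \<in> L2_disc"
    by (rule L2_disc_bounded_mult[OF bergman_spaceD(2)[OF f]
          borel_measurable_area_measure_of_continuous[OF holomorphic_on_imp_continuous_on[OF hol]] B])
  then show ?thesis
    using hol bergman_spaceD(1)[OF f] by (simp add: bergman_space_def holomorphic_on_mult)
qed

theorem lemma1p2:
  fixes n :: nat and a :: "nat \<Rightarrow> complex \<Rightarrow> complex" and \<phi> f :: "complex \<Rightarrow> complex"
  assumes "n \<ge> 1"
    and "f \<in> bergman_space"
    and "\<And>i. i \<le> n \<Longrightarrow> a i \<in> Hinf_disc"
    and "\<And>z. z \<in> unit_disc \<Longrightarrow> \<phi> z = (\<Sum>i\<le>n. a i z * cnj z ^ i)"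
  shows "(\<forall>g\<in>bergman_space.
            (\<forall>z\<in>unit_disc. toeplitz \<phi> f z = g z) \<longleftrightarrow>
            (\<forall>z\<in>unit_disc. zD_prod 2 (n + 1) g z = D_op n a f z)) \<and>
         ((\<forall>z\<in>unit_disc. toeplitz \<phi> f z = 0) \<longleftrightarrow> (\<forall>z\<in>unit_disc. D_op n a f z = 0))"
proof -
  define b where "b i z = a i z * f z" for i z
  have b: "b i \<in> bergman_space" if "i \<le> n" for i
    unfolding b_def using assms(2) assms(3)[OF that] by (intro bergman_space_Hinf_mult)
  then have "\<exists>c. disc_series c (b i)" if "i \<le> n" for i
    using disc_series_of_holomorphic bergman_spaceD(1) that by metis
  then obtain c where c: "disc_series (c i) (b i)" if "i \<le> n" for i
    by metis
  define P where "P j = (\<Prod>k=2..n+1. of_nat (j + k) :: complex)" for j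
  have P: "P j \<noteq> 0" for j
  proof -
    have "of_nat (j + k) \<noteq> (0 :: complex)" if "k \<in> {2..n+1}" for k
      unfolding of_nat_eq_0_iff using that by simp
    then show ?thesis unfolding P_def by (simp only: prod_zero_iff finite_atLeastAtMost) blast
  qed
  define T where "T j = (\<Sum>i\<le>n. of_nat (j + 1) / of_nat (j + i + 1) * c i (j + i))" for j
  have h: "\<phi> z * f z = (\<Sum>i\<le>n. cnj z ^ i * b i z)" if "z \<in> unit_disc" for z
    using assms(4)[OF that] by (simp add: b_def sum_distrib_left mult_ac)
  have T: "disc_series T (toeplitz \<phi> f)"
    unfolding T_def toeplitz_def
    by (rule bergman_projection_antianalytic_polynomial[where b = b]) (use b c h in auto)
  have PT: "disc_series (\<lambda>j. P j * T j) (D_op n a f)"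
    unfolding P_def T_def using c by (intro disc_series_D_op) (simp add: b_def[abs_def])
  have equiv: "(\<forall>z\<in>unit_disc. toeplitz \<phi> f z = g z) \<longleftrightarrow> (\<forall>z\<in>unit_disc. zD_prod 2 (n + 1) g z = D_op n a f z)"
    if g: "g \<in> bergman_space" for g
  proof -
    obtain d where d: "disc_series d g"
      using disc_series_of_holomorphic bergman_spaceD(1)[OF g] by blast
    have "disc_series (\<lambda>j. P j * d j) (zD_prod 2 (n + 1) g)"
      unfolding P_def by (rule disc_series_zD_prod[OF d])
    from disc_series_eq_iff[OF this PT] disc_series_eq_iff[OF T d] show ?thesis
      using P by (auto simp: fun_eq_iff)
  qed
  have zero: "disc_series (\<lambda>_. 0) (\<lambda>_. 0)" by (simp add: disc_series_def)
  have "(\<forall>z\<in>unit_disc. toeplitz \<phi> f z = 0) \<longleftrightarrow> (\<forall>z\<in>unit_disc. D_op n a f z = 0)"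
    unfolding disc_series_eq_iff[OF T zero] disc_series_eq_iff[OF PT zero]
    using P by (simp add: fun_eq_iff)
  with equiv show ?thesis by blast
qed

end
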